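(* Let $n$ be a positive rational number, let $\alpha_n$ denote the singular modulus of level $n$ and $g_n$ Ramanujan's class invariant (both defined in the context). Then $$\alpha_{9n}=\left(\sqrt{g^{24}_n+1}-g^{12}_n\right)^2\left(\sqrt{g^{8}_n+1}-g^{4}_n\right)^4\left(\sqrt{\frac{g^8_n+1+\sqrt{g^{16}_n-g^{8}_n+1}}{2}}-\sqrt{\frac{g^8_n-1+\sqrt{g^{16}_n-g^{8}_n+1}}{2}}\right)^8,$$ $$\alpha_{n/9}=\left(\sqrt{g^{24}_n+1}-g^{12}_n\right)^2\left(\sqrt{g^{8}_n+1}-g^{4}_n\right)^4\left(\sqrt{\frac{g^8_n+1+\sqrt{g^{16}_n-g^{8}_n+1}}{2}}+\sqrt{\frac{g^8_n-1+\sqrt{g^{16}_n-g^{8}_n+1}}{2}}\right)^8.$$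
   Context: For $|x|<1$ let $(a;x)_\infty=\prod_{k\ge0}(1-ax^k)$ and $f(-x)=(x;x)_\infty$. For a positive real $r$, the singular modulus $\alpha_r\in(0,1)$ is the unique number with $\dfrac{{}_2F_1(1/2,1/2;1;1-\alpha_r)}{{}_2F_1(1/2,1/2;1;\alpha_r)}=\sqrt{r}$ (equivalently $\alpha_r=k^2$ where $k$ is the elliptic modulus with $K'(k)/K(k)=\sqrt r$, $K$ the complete elliptic integral of the first kind). Ramanujan's class invariant is $g_r=\dfrac{f(-q)}{2^{1/4}q^{1/24}f(-q^2)}$ with $q=e^{-\pi\sqrt{r}}$. All square roots denote positive square roots of positive reals. *)

theory Defs
  imports "HOL-Analysis.Analysis"
begin

definition qpochhammer_inf :: "real \<Rightarrow> real \<Rightarrow> real" where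
  "qpochhammer_inf a x = (\<Prod>k. 1 - a * x ^ k)"

(* Stated at y = -x so that, as usual, f(-x) = (x; x)_inf. *)
definition ramanujan_f :: "real \<Rightarrow> real" where
  "ramanujan_f y = qpochhammer_inf (- y) (- y)"

lemma ramanujan_f_uminus: "ramanujan_f (- x) = qpochhammer_inf x x"
  by (simp add: ramanujan_f_def)

(* The Gauss series; only meaningful for \<bar>x\<bar> < 1. *)
definition hypergeometric_2F1 :: "real \<Rightarrow> real \<Rightarrow> real \<Rightarrow> real \<Rightarrow> real" where
  "hypergeometric_2F1 a b c x = eval_fps (fps_hypergeo [a, b] [c] 1) x"

lemma hypergeometric_2F1_altdef:
  "hypergeometric_2F1 a b c x =
     (\<Sum>k. pochhammer a k * pochhammer b k / (pochhammer c k * fact k) * x ^ k)"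
  by (simp add: hypergeometric_2F1_def eval_fps_def fps_hypergeo_def)

(* Only meaningful for r > 0, where exactly one such \<alpha> exists. *)
definition singular_modulus :: "real \<Rightarrow> real" where
  "singular_modulus r = (THE \<alpha>. 0 < \<alpha> \<and> \<alpha> < 1 \<and>
     hypergeometric_2F1 (1/2) (1/2) 1 (1 - \<alpha>) / hypergeometric_2F1 (1/2) (1/2) 1 \<alpha> = sqrt r)"

definition class_invariant_g :: "real \<Rightarrow> real" where
  "class_invariant_g r = (let q = exp (- pi * sqrt r) in
     ramanujan_f (- q) / (2 powr (1/4) * q powr (1/24) * ramanujan_f (- (q ^ 2))))"

end

theory Submission
  imports Defs
begin

text \<open>
  Let \<open>\<phi>(q) = \<Sum>q^(n^2)\<close> over the integers, \<open>\<psi>(q) = \<Sum>q^(n(n+1)/2)\<close> over the naturals, and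
  \<open>\<alpha>(q) = 16 q \<psi>(q^2)^4 / \<phi>(q)^4\<close>. Landen's transformation of the hypergeometric function \<open>F\<close>
  and the duplication formulas for \<open>\<phi>\<close> and \<open>\<psi>\<close> show that the ratio \<open>F(1 - \<alpha>(q)) / F(\<alpha>(q))\<close>
  doubles when \<open>q\<close> is squared. As the ratio behaves like \<open>- ln \<alpha> / \<pi>\<close> for small \<open>\<alpha>\<close>, iterating
  shows that it equals \<open>- ln q / \<pi>\<close>, so \<open>\<alpha>(exp (- \<pi> sqrt r))\<close> is the singular modulus of level \<open>r\<close>;
  neither Poisson summation nor \<open>F(\<alpha>(q)) = \<phi>(q)^2\<close> is needed.

  Gauss's product for \<open>\<psi>\<close> gives \<open>g^24 = (1 - \<alpha>)^2 / (4 \<alpha>)\<close>. The theta identity of degree 3 gives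
  Legendre's modular equation \<open>(\<alpha>\<beta>)^(1/4) + ((1 - \<alpha>)(1 - \<beta>))^(1/4) = 1\<close>. It is symmetric, so the moduli
  of levels \<open>9n\<close> and \<open>n/9\<close> both solve it for \<open>\<alpha>\<close> of level \<open>n\<close>. It amounts to a
  quartic for \<open>(\<beta>/\<alpha>)^(1/4)\<close> which splits into two quadratics, one of them without real roots; monotonicity
  of \<open>\<alpha>(q)\<close> assigns the two roots of the other.
\<close>

section \<open>The hypergeometric function and Landen's transformation\<close>

text \<open>These are the coefficients of the binomial series of (1 - x)^(-1/2); their squares are
  the coefficients of \<open>elliptic_F\<close>.\<close>

definition wallis_ratio :: "nat \<Rightarrow> real" where
  "wallis_ratio k = pochhammer (1/2) k / fact k"

text \<open>In terms of the complete elliptic integral of modulus k this is 2 K(k) / \<pi> at x =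
  k^2.\<close>

definition elliptic_F :: "real \<Rightarrow> real" where
  "elliptic_F x = hypergeometric_2F1 (1/2) (1/2) 1 x"

lemma wallis_ratio_Suc: "wallis_ratio (Suc k) = wallis_ratio k * ((2 * real k + 1) / (2 * real k + 2))"
  by (simp add: wallis_ratio_def pochhammer_Suc field_simps)

lemma wallis_ratio_0 [simp]: "wallis_ratio 0 = 1"
  by (simp add: wallis_ratio_def)

lemma wallis_ratio_pos: "0 < wallis_ratio k"
  by (induction k) (auto simp: wallis_ratio_Suc intro!: mult_pos_pos divide_pos_pos)

lemma wallis_ratio_le_1: "wallis_ratio k \<le> 1"
proof (induction k)
  case (Suc k)
  have "wallis_ratio k * ((2 * real k + 1) / (2 * real k + 2)) \<le> 1 * 1"
    using Suc by (intro mult_mono) auto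
  then show ?case by (simp add: wallis_ratio_Suc)
qed auto

text \<open>The partial products of Wallis's formula tend to \<pi> / 2; in this form they control
  the size of \<open>wallis_ratio\<close> with the exact constant.\<close>

lemma wallis_product_eq:
  "(\<Prod>k=1..n. (4 * real k ^ 2) / (4 * real k ^ 2 - 1)) = inverse ((wallis_ratio n)\<^sup>2 * (2 * real n + 1))"
proof (induction n)
  case (Suc n)
  have nz: "wallis_ratio n \<noteq> 0" "2 * real n + 1 \<noteq> 0" "2 * real n + 2 \<noteq> 0" "2 * real n + 3 \<noteq> 0"
    using wallis_ratio_pos[of n] by auto
  have "4 * real (Suc n) ^ 2 - 1 = (2 * real n + 1) * (2 * real n + 3)"
    and "4 * real (Suc n) ^ 2 = (2 * real n + 2)\<^sup>2"
    and "2 * real (Suc n) + 1 = 2 * real n + 3"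
    by (simp_all add: power2_eq_square algebra_simps)
  then have "(\<Prod>k=1..Suc n. (4 * real k ^ 2) / (4 * real k ^ 2 - 1)) =
     inverse ((wallis_ratio n)\<^sup>2 * (2 * real n + 1)) * ((2 * real n + 2)\<^sup>2 / ((2 * real n + 1) * (2 * real n + 3)))"
    using Suc.IH by simp
  also have "\<dots> = inverse ((wallis_ratio n * ((2 * real n + 1) / (2 * real n + 2)))\<^sup>2 * (2 * real n + 3))"
    unfolding power_mult_distrib power_divide using nz by (simp add: field_simps power2_eq_square)
  also have "\<dots> = inverse ((wallis_ratio (Suc n))\<^sup>2 * (2 * real (Suc n) + 1))"
    by (simp add: wallis_ratio_Suc add.commute)
  finally show ?case .
qed simp

text \<open>Every factor of Wallis's product is at least 1, so the partial products increase and
  stay below their limit \<pi> / 2.\<close>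

lemma wallis_ratio_sq_lower: "2 / (pi * (2 * real n + 1)) \<le> (wallis_ratio n)\<^sup>2"
proof -
  let ?W = "\<lambda>n. \<Prod>k=1..n. (4 * real k ^ 2) / (4 * real k ^ 2 - 1)"
  have ge1: "1 \<le> (4 * real k ^ 2) / (4 * real k ^ 2 - 1)" if "k \<ge> 1" for k
  proof -
    have "1 \<le> real k ^ 2" using that by simp
    then show ?thesis by (simp add: field_simps)
  qed
  have "incseq ?W"
  proof (rule incseq_SucI)
    fix n
    have "0 \<le> ?W n"
    proof (rule prod_nonneg)
      fix k assume "k \<in> {1..n}"
      then show "0 \<le> (4 * real k ^ 2) / (4 * real k ^ 2 - 1)"
        using ge1[of k] by (intro order_trans[OF zero_le_one]) auto
    qed
    then have "?W n * 1 \<le> ?W n * ((4 * real (Suc n) ^ 2) / (4 * real (Suc n) ^ 2 - 1))"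
      using ge1[of "Suc n"] by (intro mult_left_mono) simp_all
    then show "?W n \<le> ?W (Suc n)"
      by (simp only: prod.nat_ivl_Suc' mult_1_right mult.commute)
  qed
  from incseq_le[OF this wallis, of n]
  have "inverse ((wallis_ratio n)\<^sup>2 * (2 * real n + 1)) \<le> pi / 2"
    unfolding wallis_product_eq .
  moreover have *: "2 / (pi * d) \<le> w" if "inverse (w * d) \<le> pi / 2" "0 < w" "0 < d" for w d :: real
  proof -
    have "inverse (w * d) * (2 * w / pi) \<le> pi / 2 * (2 * w / pi)"
      using that by (intro mult_right_mono) auto
    then show ?thesis using that by (simp add: field_simps)
  qed
  ultimately show ?thesis using wallis_ratio_pos[of n] by simp
qed

text \<open>The sequence n (\<open>wallis_ratio\<close> n)^2 increases to 1 / \<pi>. Together with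
  the lower bound this gives the leading constant 1 / \<pi> of the logarithmic growth of
  \<open>elliptic_F\<close> at 1.\<close>

lemma wallis_ratio_sq_upper:
  assumes "n > 0"
  shows "(wallis_ratio n)\<^sup>2 \<le> 1 / (pi * real n)"
proof -
  let ?u = "\<lambda>n. real n * (wallis_ratio n)\<^sup>2"
  have inc: "incseq ?u"
  proof (rule incseq_SucI)
    fix n
    \<comment> \<open>The right side exceeds the left by exactly n + 1.\<close>
    have "real n * (2 * real n + 2)\<^sup>2 \<le> (real n + 1) * (2 * real n + 1)\<^sup>2"
      by (simp add: power2_eq_square algebra_simps)
    then have "real n \<le> (real n + 1) * ((2 * real n + 1) / (2 * real n + 2))\<^sup>2"
      by (simp add: power_divide pos_le_divide_eq)
    then have "(wallis_ratio n)\<^sup>2 * real n \<le> (wallis_ratio n)\<^sup>2 * ((real n + 1) * ((2 * real n + 1) / (2 * real n + 2))\<^sup>2)"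
      by (rule mult_left_mono) simp
    then show "?u n \<le> ?u (Suc n)"
      unfolding wallis_ratio_Suc power_mult_distrib by (simp add: mult_ac add.commute)
  qed
  have "(\<lambda>n. real n / (2 * real n + 1) * inverse (inverse ((wallis_ratio n)\<^sup>2 * (2 * real n + 1)))) \<longlonglongrightarrow> 1/2 * inverse (pi / 2)"
  proof (intro tendsto_mult tendsto_inverse)
    show "(\<lambda>n. inverse ((wallis_ratio n)\<^sup>2 * (2 * real n + 1))) \<longlonglongrightarrow> pi / 2"
      using wallis unfolding wallis_product_eq .
    show "(\<lambda>n. real n / (2 * real n + 1)) \<longlonglongrightarrow> 1 / 2"
      by real_asymp
  qed auto
  moreover have "real n / (2 * real n + 1) * inverse (inverse ((wallis_ratio n)\<^sup>2 * (2 * real n + 1))) = ?u n" for n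
  proof -
    have "2 * real n + 1 \<noteq> 0" by linarith
    then show ?thesis by (simp add: field_simps)
  qed
  ultimately have "?u \<longlonglongrightarrow> 1 / pi" by simp
  from incseq_le[OF inc this, of n] show ?thesis using assms by (simp add: field_simps)
qed

section \<open>Monotonicity and growth of the hypergeometric function\<close>

lemma elliptic_F_sums:
  assumes "\<bar>x\<bar> < 1"
  shows "(\<lambda>k. (wallis_ratio k)\<^sup>2 * x ^ k) sums elliptic_F x"
proof -
  have "summable (\<lambda>k. (wallis_ratio k)\<^sup>2 * x ^ k)"
  proof (rule summable_comparison_test')
    show "summable (\<lambda>k. \<bar>x\<bar> ^ k)" using assms by (intro summable_geometric) auto
    show "norm ((wallis_ratio k)\<^sup>2 * x ^ k) \<le> \<bar>x\<bar> ^ k" for k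
      using wallis_ratio_pos[of k] wallis_ratio_le_1[of k]
      by (auto simp: abs_mult power_abs intro!: mult_left_le_one_le power_le_one)
  qed
  moreover have "elliptic_F x = (\<Sum>k. (wallis_ratio k)\<^sup>2 * x ^ k)"
    unfolding elliptic_F_def hypergeometric_2F1_altdef wallis_ratio_def
    by (simp add: pochhammer_fact [symmetric] power2_eq_square)
  ultimately show ?thesis by (simp add: summable_sums)
qed

lemma elliptic_F_mono:
  assumes "0 \<le> x" "x < y" "y < 1"
  shows "elliptic_F x < elliptic_F y"
proof -
  have "(\<lambda>k. (wallis_ratio k)\<^sup>2 * y ^ k - (wallis_ratio k)\<^sup>2 * x ^ k) sums (elliptic_F y - elliptic_F x)"
    using assms by (intro sums_diff elliptic_F_sums) auto
  then have s: "summable (\<lambda>k. (wallis_ratio k)\<^sup>2 * y ^ k - (wallis_ratio k)\<^sup>2 * x ^ k)"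
     and e: "elliptic_F y - elliptic_F x = (\<Sum>k. (wallis_ratio k)\<^sup>2 * y ^ k - (wallis_ratio k)\<^sup>2 * x ^ k)"
    by (auto simp: sums_iff)
  have "0 < (\<Sum>k. (wallis_ratio k)\<^sup>2 * y ^ k - (wallis_ratio k)\<^sup>2 * x ^ k)"
  proof (rule suminf_pos2[OF s, of 1])
    show "0 \<le> (wallis_ratio k)\<^sup>2 * y ^ k - (wallis_ratio k)\<^sup>2 * x ^ k" for k
      using assms by (auto intro!: mult_left_mono power_mono)
    show "0 < (wallis_ratio 1)\<^sup>2 * y ^ 1 - (wallis_ratio 1)\<^sup>2 * x ^ 1"
      using assms wallis_ratio_pos[of 1] by simp
  qed
  then show ?thesis using e by simp
qed

lemma elliptic_F_0: "elliptic_F 0 = 1"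
proof -
  have "(\<lambda>k. (wallis_ratio k)\<^sup>2 * 0 ^ k) sums (wallis_ratio 0)\<^sup>2"
    by (rule powser_sums_zero)
  with elliptic_F_sums[of 0] show ?thesis by (simp add: sums_iff)
qed

lemma elliptic_F_ge_1: "0 \<le> x \<Longrightarrow> x < 1 \<Longrightarrow> 1 \<le> elliptic_F x"
  using elliptic_F_mono[of 0 x] by (cases "x = 0") (auto simp: elliptic_F_0)

lemma elliptic_F_le: 
  assumes "0 \<le> x" "x < 1"
  shows "elliptic_F x \<le> 1 / (1 - x)"
proof (rule sums_le)
  show "(\<lambda>k. (wallis_ratio k)\<^sup>2 * x ^ k) sums elliptic_F x"
    using assms by (intro elliptic_F_sums) auto
  show "(\<lambda>k. x ^ k) sums (1 / (1 - x))"
    using assms by (intro geometric_sums) auto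
  show "(wallis_ratio k)\<^sup>2 * x ^ k \<le> x ^ k" for k
    using wallis_ratio_pos[of k] wallis_ratio_le_1[of k] assms
    by (intro mult_left_le_one_le power_le_one) auto
qed

lemma sums_neg_ln_one_minus:
  fixes y :: real
  assumes "\<bar>y\<bar> < 1"
  shows "(\<lambda>n. y ^ n / real n) sums (- ln (1 - y))"
  using sums_minus[OF ln_series'[of "- y"]] assms by simp

text \<open>Termwise comparison with the series of - ln (1 - y) / \<pi>, using the upper bound on
  the coefficients; that bound starts at n = 1, and the constant term accounts for the extra
  1.\<close>

lemma elliptic_F_log_upper:
  assumes "0 \<le> y" "y < 1"
  shows "elliptic_F y \<le> 1 - ln (1 - y) / pi"
proof -
  have "(\<lambda>n. (if n = 0 then 1 else 0) + 1 / pi * (y ^ n / real n)) sums (1 + 1 / pi * (- ln (1 - y)))"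
  proof (rule sums_add)
    show "(\<lambda>n. if n = 0 then 1 else 0 :: real) sums 1"
      using sums_single[of 0 "\<lambda>_. 1::real"] by simp
    show "(\<lambda>n. 1 / pi * (y ^ n / real n)) sums (1 / pi * (- ln (1 - y)))"
      using assms by (intro sums_mult sums_neg_ln_one_minus) auto
  qed
  moreover have "(wallis_ratio n)\<^sup>2 * y ^ n \<le> (if n = 0 then 1 else 0) + 1 / pi * (y ^ n / real n)" for n
  proof (cases "n = 0")
    case False
    then have "(wallis_ratio n)\<^sup>2 * y ^ n \<le> 1 / (pi * real n) * y ^ n"
      using assms by (intro mult_right_mono wallis_ratio_sq_upper) auto
    then show ?thesis using False by simp
  qed simp
  ultimately have "elliptic_F y \<le> 1 + 1 / pi * (- ln (1 - y))"
    using assms by (intro sums_le[OF _ elliptic_F_sums]) auto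
  then show ?thesis by simp
qed

text \<open>The n-th term is compared with the term of index n + 1 of the logarithmic series. The
  shift costs a factor y \<le> 1 and replaces 2n + 1 by 2n + 2, both in the right direction.\<close>

lemma elliptic_F_log_lower:
  assumes "0 \<le> y" "y < 1"
  shows "- ln (1 - y) / pi \<le> elliptic_F y"
proof -
  have "(\<lambda>n. y ^ Suc n / real (Suc n)) sums (- ln (1 - y))"
    using sums_neg_ln_one_minus[of y] assms by (subst sums_Suc_iff) auto
  then have "(\<lambda>n. 1 / pi * (y ^ Suc n / real (Suc n))) sums (1 / pi * (- ln (1 - y)))"
    by (rule sums_mult)
  moreover have "1 / pi * (y ^ Suc n / real (Suc n)) \<le> (wallis_ratio n)\<^sup>2 * y ^ n" for n
  proof -
    have "1 / pi * (y ^ Suc n / real (Suc n)) = (2 / (pi * (2 * real n + 2))) * (y * y ^ n)"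
    proof -
      have "2 * real n + 2 = 2 * real (Suc n)" by simp
      moreover have "1 / pi * (A / N) = 2 / (pi * (2 * N)) * A" for A N :: real by simp
      ultimately show ?thesis by (simp only: power_Suc)
    qed
    also have "\<dots> \<le> (2 / (pi * (2 * real n + 1))) * (1 * y ^ n)"
      using assms by (intro mult_mono divide_left_mono mult_left_mono) auto
    also have "\<dots> \<le> (wallis_ratio n)\<^sup>2 * (1 * y ^ n)"
      using assms by (intro mult_right_mono wallis_ratio_sq_lower) auto
    finally show ?thesis by simp
  qed
  ultimately have "1 / pi * (- ln (1 - y)) \<le> elliptic_F y"
    using assms by (intro sums_le[OF _ _ elliptic_F_sums]) auto
  then show ?thesis by simp
qed

section \<open>Mean values over the circle\<close>

lemma has_integral_cos_int:
  "((\<lambda>t. cos (of_int m * t)) has_integral (if m = 0 then 2 * pi else 0)) {0..2 * pi}"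
proof (cases "m = 0")
  case True
  then show ?thesis using has_integral_const_real[of "1::real" 0 "2 * pi"] by simp
next
  case False
  have "((\<lambda>t. cos (of_int m * t)) has_integral (sin (of_int m * (2 * pi)) / of_int m - sin (of_int m * 0) / of_int m)) {0..2 * pi}"
    using False
    by (intro fundamental_theorem_of_calculus)
       (auto intro!: derivative_eq_intros simp flip: has_real_derivative_iff_has_vector_derivative)
  moreover have "sin (of_int m * (2 * pi)) = 0"
    using sin_int_2pin[of m] by (simp add: mult_ac)
  ultimately show ?thesis using False by simp
qed

text \<open>The squared modulus expands into a double sum of cos ((j - k) t), of which only the
  diagonal survives integration over a period.\<close>

lemma parseval_finite:
  fixes b :: "nat \<Rightarrow> real"
  shows "((\<lambda>t. (norm (\<Sum>k<N. of_real (b k) * cis t ^ k))\<^sup>2) has_integral (2 * pi * (\<Sum>k<N. (b k)\<^sup>2))) {0..2 * pi}"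
proof -
  have "(norm (\<Sum>k<N. of_real (b k) * cis t ^ k))\<^sup>2 =
     (\<Sum>j<N. \<Sum>k<N. b j * b k * cos (of_int (int j - int k) * t))" for t
  proof -
    have "(\<Sum>k<N. of_real (b k) * cis t ^ k) = Complex (\<Sum>k<N. b k * cos (real k * t)) (\<Sum>k<N. b k * sin (real k * t))"
      by (simp add: complex_eq_iff Complex.DeMoivre)
    then have "(norm (\<Sum>k<N. of_real (b k) * cis t ^ k))\<^sup>2 =
       (\<Sum>k<N. b k * cos (real k * t))\<^sup>2 + (\<Sum>k<N. b k * sin (real k * t))\<^sup>2"
      by (simp add: cmod_power2)
    also have "\<dots> = (\<Sum>j<N. \<Sum>k<N. b j * b k * cos (of_int (int j - int k) * t))"
      by (simp add: power2_eq_square sum_product sum.distrib [symmetric] left_diff_distrib cos_diff algebra_simps)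
    finally show ?thesis .
  qed
  moreover have "((\<lambda>t. \<Sum>j<N. \<Sum>k<N. b j * b k * cos (of_int (int j - int k) * t)) has_integral
     (\<Sum>j<N. \<Sum>k<N. b j * b k * (if int j - int k = 0 then 2 * pi else 0))) {0..2 * pi}"
    by (intro has_integral_sum has_integral_mult_right has_integral_cos_int) auto
  moreover have "(\<Sum>j<N. \<Sum>k<N. b j * b k * (if int j - int k = 0 then 2 * pi else 0)) = 2 * pi * (\<Sum>k<N. (b k)\<^sup>2)"
  proof -
    have "(\<Sum>k<N. b j * b k * (if int j - int k = 0 then 2 * pi else 0)) = 2 * pi * (b j)\<^sup>2" if "j < N" for j
    proof -
      have "(\<Sum>k<N. b j * b k * (if int j - int k = 0 then 2 * pi else 0)) = (\<Sum>k<N. if j = k then b j * b k * (2 * pi) else 0)"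
        by (intro sum.cong) auto
      also have "\<dots> = 2 * pi * (b j)\<^sup>2" using that by (simp add: power2_eq_square)
      finally show ?thesis .
    qed
    then show ?thesis by (simp add: sum_distrib_left)
  qed
  ultimately show ?thesis by simp
qed

lemma one_plus_cis_norm: "(norm (1 + cis t))\<^sup>2 = 4 * (cos (t / 2))\<^sup>2"
proof -
  have "(norm (1 + cis t))\<^sup>2 = (1 + cos t)\<^sup>2 + (sin t)\<^sup>2"
    by (simp add: cmod_power2)
  also have "\<dots> = 2 * (1 + cos t)"
    using sin_cos_squared_add[of t] by (simp add: power2_eq_square algebra_simps)
  also have "\<dots> = 4 * (cos (t / 2))\<^sup>2"
    using cos_double_cos[of "t / 2"] by simp
  finally show ?thesis .
qed

lemma wallis_ratio_central_binomial: "wallis_ratio k = real ((2 * k) choose k) / 4 ^ k"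
proof -
  have "real ((2 * k) choose k) = fact (2 * k) / (fact k * fact k)"
    by (subst binomial_fact) auto
  also have "\<dots> = 4 ^ k * wallis_ratio k"
    unfolding fact_double wallis_ratio_def by (simp add: power_mult)
  finally show ?thesis by simp
qed

text \<open>Parseval for the polynomial (1 + e^(it))^k: its squared modulus is (4 cos^2 (t/2))^k,
  and the squares of the binomial coefficients add up to the central one.\<close>

lemma has_integral_cos_half_power:
  "((\<lambda>t. (cos (t / 2))\<^sup>2 ^ k) has_integral (2 * pi * wallis_ratio k)) {0..2 * pi}"
proof -
  have "(\<Sum>j<Suc k. of_real (real (k choose j)) * cis t ^ j) = (1 + cis t) ^ k" for t
    using binomial_ring[of "cis t" 1 k] by (simp add: lessThan_Suc_atMost add.commute)
  moreover have "(norm ((1 + cis t) ^ k))\<^sup>2 = 4 ^ k * (cos (t / 2))\<^sup>2 ^ k" for t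
  proof -
    have "(norm ((1 + cis t) ^ k))\<^sup>2 = ((norm (1 + cis t))\<^sup>2) ^ k"
      by (simp add: norm_power mult.commute flip: power_mult)
    then show ?thesis by (simp only: one_plus_cis_norm power_mult_distrib)
  qed
  moreover have "(\<Sum>j<Suc k. (real (k choose j))\<^sup>2) = real ((2 * k) choose k)"
    unfolding choose_square_sum[symmetric] by (simp only: lessThan_Suc_atMost of_nat_sum of_nat_power)
  ultimately have "((\<lambda>t. 4 ^ k * (cos (t / 2))\<^sup>2 ^ k) has_integral (2 * pi * real ((2 * k) choose k))) {0..2 * pi}"
    using parseval_finite[where N = "Suc k" and b = "\<lambda>j. real (k choose j)"] by simp
  then have "((\<lambda>t. 1 / 4 ^ k * (4 ^ k * (cos (t / 2))\<^sup>2 ^ k)) has_integral (1 / 4 ^ k * (2 * pi * real ((2 * k) choose k)))) {0..2 * pi}"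
    by (rule has_integral_mult_right)
  then show ?thesis by (simp add: wallis_ratio_central_binomial)
qed

text \<open>The type is kept general because the binomial series is used once over the reals and
  once over the complex numbers.\<close>

lemma gchoose_minus_half: "((- (1/2)) gchoose k) * (- z) ^ k = of_real (wallis_ratio k) * z ^ k"
  for z :: "'a :: {field_char_0, real_normed_field}"
proof -
  have "pochhammer (1/2 :: 'a) k = of_real (pochhammer (1/2) k)"
    using pochhammer_of_real[of "1/2" k, where 'a = 'a] by simp
  moreover have "(- z) ^ k = (-1) ^ k * z ^ k"
    by (rule power_minus)
  moreover have "(-1) ^ k * (-1) ^ k = (1 :: 'a)"
    by (simp flip: power_mult_distrib)
  ultimately show ?thesis
    by (simp add: gbinomial_pochhammer wallis_ratio_def)
qed

lemma sum_power_le_geometric: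
  fixes x :: real
  assumes "0 \<le> x" "x < 1"
  shows "(\<Sum>k<N. x ^ k) \<le> 1 / (1 - x)"
  using sum_le_suminf[OF summable_geometric[of x], of "{..<N}"] suminf_geometric[of x] assms by simp

text \<open>Termwise integration of the binomial series in m cos^2 (t/2). The series contributes one
  factor \<open>wallis_ratio\<close> and the mean of the cosine power the other; the geometric
  series in m dominates the partial sums.\<close>

lemma has_integral_cos_average:
  assumes "0 \<le> m" "m < 1"
  shows "((\<lambda>t. (1 - m * (cos (t / 2))\<^sup>2) powr (- (1/2))) has_integral (2 * pi * elliptic_F m)) {0..2 * pi}"
proof (rule has_integral_dominated_convergence)
  show "((\<lambda>t. \<Sum>k<N. wallis_ratio k * m ^ k * ((cos (t / 2))\<^sup>2 ^ k)) has_integral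
      (\<Sum>k<N. wallis_ratio k * m ^ k * (2 * pi * wallis_ratio k))) {0..2 * pi}" for N
    by (intro has_integral_sum has_integral_mult_right has_integral_cos_half_power) auto
  show "(\<lambda>_. 1 / (1 - m)) integrable_on {0..2 * pi}" by (rule integrable_const_ivl)
  have c: "0 \<le> (cos (t / 2))\<^sup>2" "(cos (t / 2))\<^sup>2 \<le> 1" for t :: real
    by (auto simp: abs_square_le_1)
  show "\<forall>t\<in>{0..2 * pi}. norm (\<Sum>k<N. wallis_ratio k * m ^ k * ((cos (t / 2))\<^sup>2 ^ k)) \<le> 1 / (1 - m)" for N
  proof
    fix t :: real
    have "norm (\<Sum>k<N. wallis_ratio k * m ^ k * ((cos (t / 2))\<^sup>2 ^ k)) \<le> (\<Sum>k<N. m ^ k)"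
    proof (rule sum_norm_le)
      fix k
      have "wallis_ratio k * m ^ k * ((cos (t / 2))\<^sup>2 ^ k) \<le> 1 * m ^ k * 1"
        using assms wallis_ratio_le_1[of k] wallis_ratio_pos[of k] c[of t]
        by (intro mult_mono c power_le_one) auto
      moreover have "0 \<le> wallis_ratio k * m ^ k * ((cos (t / 2))\<^sup>2 ^ k)"
        using assms wallis_ratio_pos[of k] c[of t] by (intro mult_nonneg_nonneg) auto
      ultimately show "norm (wallis_ratio k * m ^ k * ((cos (t / 2))\<^sup>2 ^ k)) \<le> m ^ k"
        by (simp add: abs_of_nonneg del: power_even_abs)
    qed
    also have "\<dots> \<le> 1 / (1 - m)"
      using assms by (rule sum_power_le_geometric)
    finally show "norm (\<Sum>k<N. wallis_ratio k * m ^ k * ((cos (t / 2))\<^sup>2 ^ k)) \<le> 1 / (1 - m)" .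
  qed
  show "\<forall>t\<in>{0..2 * pi}. (\<lambda>N. \<Sum>k<N. wallis_ratio k * m ^ k * ((cos (t / 2))\<^sup>2 ^ k)) \<longlonglongrightarrow> (1 - m * (cos (t / 2))\<^sup>2) powr (- (1/2))"
  proof
    fix t :: real
    have "\<bar>m * (cos (t / 2))\<^sup>2\<bar> \<le> m * 1"
      using assms c[of t] by (auto simp: abs_mult intro!: mult_left_le)
    then have "\<bar>- (m * (cos (t / 2))\<^sup>2)\<bar> < 1" using assms by simp
    from gen_binomial_real[OF this, of "- (1/2)"]
    have "(\<lambda>k. wallis_ratio k * (m * (cos (t / 2))\<^sup>2) ^ k) sums (1 - m * (cos (t / 2))\<^sup>2) powr (- (1/2))"
      unfolding gchoose_minus_half by simp
    then show "(\<lambda>N. \<Sum>k<N. wallis_ratio k * m ^ k * ((cos (t / 2))\<^sup>2 ^ k)) \<longlonglongrightarrow> (1 - m * (cos (t / 2))\<^sup>2) powr (- (1/2))"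
      unfolding sums_def power_mult_distrib by (simp only: mult.assoc)
  qed
  have "(\<lambda>k. (wallis_ratio k)\<^sup>2 * m ^ k) sums elliptic_F m"
    using assms by (intro elliptic_F_sums) auto
  from sums_mult[OF this, of "2 * pi"]
  show "(\<lambda>N. \<Sum>k<N. wallis_ratio k * m ^ k * (2 * pi * wallis_ratio k)) \<longlonglongrightarrow> 2 * pi * elliptic_F m"
    unfolding sums_def by (simp add: power2_eq_square mult_ac)
qed

text \<open>Parseval is applied to the partial sums of the binomial series of (1 - x e^(it))^(-1/2),
  and dominated convergence carries it to the limit.\<close>

lemma has_integral_norm_average:
  assumes "0 \<le> x" "x < 1"
  shows "((\<lambda>t. inverse (norm (1 - of_real x * cis t))) has_integral (2 * pi * elliptic_F (x\<^sup>2))) {0..2 * pi}"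
proof (rule has_integral_dominated_convergence)
  let ?S = "\<lambda>N t. \<Sum>k<N. of_real (wallis_ratio k * x ^ k) * cis t ^ k"
  show "((\<lambda>t. (norm (?S N t))\<^sup>2) has_integral (2 * pi * (\<Sum>k<N. (wallis_ratio k * x ^ k)\<^sup>2))) {0..2 * pi}" for N
    by (rule parseval_finite)
  show "(\<lambda>_. (1 / (1 - x))\<^sup>2) integrable_on {0..2 * pi}" by (rule integrable_const_ivl)
  show "\<forall>t\<in>{0..2 * pi}. norm ((norm (?S N t))\<^sup>2) \<le> (1 / (1 - x))\<^sup>2" for N
  proof
    fix t :: real
    have "norm (?S N t) \<le> (\<Sum>k<N. x ^ k)"
      using assms wallis_ratio_le_1 wallis_ratio_pos
      by (intro sum_norm_le) (auto simp: norm_mult norm_power abs_mult abs_of_pos intro!: mult_left_le_one_le less_imp_le[OF wallis_ratio_pos])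
    also have "\<dots> \<le> 1 / (1 - x)"
      using assms by (rule sum_power_le_geometric)
    finally have "(norm (?S N t))\<^sup>2 \<le> (1 / (1 - x))\<^sup>2"
      by (intro power_mono) auto
    then show "norm ((norm (?S N t))\<^sup>2) \<le> (1 / (1 - x))\<^sup>2" by simp
  qed
  show "\<forall>t\<in>{0..2 * pi}. (\<lambda>N. (norm (?S N t))\<^sup>2) \<longlonglongrightarrow> inverse (norm (1 - of_real x * cis t))"
  proof
    fix t :: real
    define w where "w = of_real x * cis t"
    have w: "norm w < 1" using assms by (simp add: w_def norm_mult)
    then have w1: "1 - w \<noteq> 0" by auto
    have "(\<lambda>k. of_real (wallis_ratio k) * w ^ k) sums (1 - w) powr (- (1/2))"
      using gen_binomial_complex[of "- w" "- (1/2)"] w unfolding gchoose_minus_half by simp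
    then have "(\<lambda>N. ?S N t) \<longlonglongrightarrow> (1 - w) powr (- (1/2))"
      unfolding sums_def w_def power_mult_distrib by (simp add: mult.assoc)
    then have "(\<lambda>N. (norm (?S N t))\<^sup>2) \<longlonglongrightarrow> (norm ((1 - w) powr (- (1/2))))\<^sup>2"
      by (intro tendsto_intros)
    \<comment> \<open>The squared norm of the principal root is the norm of its square, and that
      square is 1 / (1 - w).\<close>
    also have "(norm ((1 - w) powr (- (1/2))))\<^sup>2 = norm ((1 - w) powr (- (1/2)) * (1 - w) powr (- (1/2)))"
      by (simp add: norm_mult power2_eq_square)
    also have "(1 - w) powr (- (1/2)) * (1 - w) powr (- (1/2)) = inverse (1 - w)"
    proof -
      have "(1 - w) powr (- (1/2)) * (1 - w) powr (- (1/2)) = (1 - w) powr (- 1)"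
        unfolding powr_add [symmetric] by simp
      then show ?thesis using w1 by (simp add: powr_minus)
    qed
    finally show "(\<lambda>N. (norm (?S N t))\<^sup>2) \<longlonglongrightarrow> inverse (norm (1 - of_real x * cis t))"
      by (simp add: w_def norm_inverse)
  qed
  have "x\<^sup>2 < 1" using assms by (simp add: abs_square_less_1)
  then have "(\<lambda>k. (wallis_ratio k)\<^sup>2 * (x\<^sup>2) ^ k) sums elliptic_F (x\<^sup>2)"
    by (intro elliptic_F_sums) auto
  from sums_mult[OF this, of "2 * pi"]
  show "(\<lambda>N. 2 * pi * (\<Sum>k<N. (wallis_ratio k * x ^ k)\<^sup>2)) \<longlonglongrightarrow> 2 * pi * elliptic_F (x\<^sup>2)"
    unfolding sums_def by (simp add: sum_distrib_left power_mult_distrib mult.commute flip: power_mult)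
qed

text \<open>
  The mean of \<open>1 / |1 - x e^(it)|\<close> is computed twice: by Parseval applied to the binomial series of
  \<open>(1 - x e^(it))^(-1/2)\<close>, and by expanding \<open>|1 - x e^(it)|^2 = (1 + x)^2 (1 - m cos^2 (t/2))\<close>
  in powers of the squared cosine, where \<open>m = 4x / (1 + x)^2\<close>.
\<close>
theorem elliptic_F_landen:
  assumes "0 \<le> x" "x < 1"
  shows "elliptic_F (4 * x / (1 + x)\<^sup>2) = (1 + x) * elliptic_F (x\<^sup>2)"
proof -
  define m where "m = 4 * x / (1 + x)\<^sup>2"
  have "0 < (1 - x)\<^sup>2" using assms by simp
  then have "4 * x < (1 + x)\<^sup>2" by (simp add: power2_eq_square algebra_simps)
  then have m: "0 \<le> m" "m < 1" using assms by (auto simp: m_def)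
  have "(1 - m * (cos (t / 2))\<^sup>2) powr (- (1/2)) = (1 + x) * inverse (norm (1 - of_real x * cis t))" for t
  proof -
    have n: "0 < norm (1 - of_real x * cis t)"
    proof -
      have "norm (of_real x * cis t) < 1" using assms by (simp add: norm_mult)
      then show ?thesis by auto
    qed
    have "(norm (1 - of_real x * cis t))\<^sup>2 = (1 - x * cos t)\<^sup>2 + (x * sin t)\<^sup>2"
      by (simp add: cmod_power2)
    also have "\<dots> = 1 - 2 * x * cos t + x\<^sup>2 * ((sin t)\<^sup>2 + (cos t)\<^sup>2)"
    proof -
      have "(1 - x * c)\<^sup>2 + (x * s)\<^sup>2 = 1 - 2 * x * c + x\<^sup>2 * (s\<^sup>2 + c\<^sup>2)" for c s
        by (simp add: power2_eq_square algebra_simps)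
      then show ?thesis .
    qed
    also have "\<dots> = (1 + x)\<^sup>2 - 4 * x * (cos (t / 2))\<^sup>2"
    proof -
      have "cos t = 2 * (cos (t / 2))\<^sup>2 - 1" using cos_double_cos[of "t / 2"] by simp
      moreover have "1 - 2 * x * c + x\<^sup>2 * 1 = (1 + x)\<^sup>2 - 4 * x * d" if "c = 2 * d - 1" for c d
        unfolding that by (simp add: power2_eq_square algebra_simps)
      ultimately show ?thesis
        unfolding sin_cos_squared_add by blast
    qed
    also have "\<dots> = (1 + x)\<^sup>2 * (1 - m * (cos (t / 2))\<^sup>2)"
      using assms by (simp add: m_def field_simps)
    finally have eq: "1 - m * (cos (t / 2))\<^sup>2 = (norm (1 - of_real x * cis t) / (1 + x))\<^sup>2"
      using assms by (simp add: power_divide field_simps)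
    have "(d\<^sup>2) powr (- (1/2)) = inverse d" if "0 < d" for d :: real
      using that by (simp add: powr_minus powr_half_sqrt)
    moreover have "0 < norm (1 - of_real x * cis t) / (1 + x)" using assms n by simp
    moreover have "inverse (norm (1 - of_real x * cis t) / (1 + x)) = (1 + x) * inverse (norm (1 - of_real x * cis t))"
      by (simp add: inverse_eq_divide)
    ultimately show ?thesis unfolding eq by simp
  qed
  then have "((\<lambda>t. (1 + x) * inverse (norm (1 - of_real x * cis t))) has_integral (2 * pi * elliptic_F m)) {0..2 * pi}"
    using has_integral_cos_average[OF m] by simp
  moreover have "((\<lambda>t. (1 + x) * inverse (norm (1 - of_real x * cis t))) has_integral ((1 + x) * (2 * pi * elliptic_F (x\<^sup>2)))) {0..2 * pi}"
    by (intro has_integral_mult_right has_integral_norm_average assms)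
  ultimately have "2 * pi * elliptic_F m = (1 + x) * (2 * pi * elliptic_F (x\<^sup>2))"
    by (rule has_integral_unique)
  then show ?thesis unfolding m_def by simp
qed

section \<open>Theta series\<close>

lemma summable_on_int_geometric:
  fixes r :: real
  assumes "0 \<le> r" "r < 1"
  shows "(\<lambda>n::int. r ^ nat \<bar>n\<bar>) summable_on UNIV"
proof -
  have geo: "(\<lambda>n. r ^ n) summable_on UNIV"
    using assms by (intro norm_summable_imp_summable_on) (auto intro: summable_geometric)
  have pos: "(\<lambda>n::int. r ^ nat \<bar>n\<bar>) summable_on range int"
    by (subst summable_on_reindex) (auto simp: o_def geo)
  have neg: "(\<lambda>n::int. r ^ nat \<bar>n\<bar>) summable_on range (\<lambda>n. - int n)"
    by (subst summable_on_reindex) (auto simp: o_def geo inj_def)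
  have "UNIV = range int \<union> range (\<lambda>n. - int n)"
  proof (intro set_eqI iffI UnCI)
    fix n :: int
    assume "n \<notin> range (\<lambda>n. - int n)"
    then have "n = int (nat n)"
      by (cases "n \<ge> 0") (auto simp: image_iff dest: spec[of _ "nat (- n)"])
    then show "n \<in> range int" by (rule range_eqI)
  qed simp
  with summable_on_union[OF pos neg] show ?thesis
    by simp
qed

text \<open>The lower bound on the exponent is |n| - 1 because the triangular exponent n(n + 1)/2
  attains it at n = -1 and n = -2. The base may be negative, so the comparison is made with absolute
  values.\<close>

lemma summable_on_int_powi:
  fixes q :: real and e :: "int \<Rightarrow> int"
  assumes "q \<noteq> 0" "\<bar>q\<bar> < 1" "\<And>n. \<bar>n\<bar> - 1 \<le> e n"
  shows "(\<lambda>n. q powi e n) summable_on UNIV"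
proof (rule abs_summable_summable, rule summable_on_comparison_test)
  show "(\<lambda>n::int. inverse \<bar>q\<bar> * \<bar>q\<bar> ^ nat \<bar>n\<bar>) summable_on UNIV"
    using assms by (intro summable_on_cmult_right summable_on_int_geometric) auto
  show "norm (q powi e n) \<le> inverse \<bar>q\<bar> * \<bar>q\<bar> ^ nat \<bar>n\<bar>" for n
  proof -
    have "\<bar>q\<bar> powi e n \<le> \<bar>q\<bar> powi (\<bar>n\<bar> - 1)"
      using assms by (intro power_int_decreasing) auto
    also have "\<dots> = inverse \<bar>q\<bar> * \<bar>q\<bar> powi \<bar>n\<bar>"
      using assms(1) by (subst power_int_diff) (auto simp: divide_inverse)
    also have "\<bar>q\<bar> powi \<bar>n\<bar> = \<bar>q\<bar> ^ nat \<bar>n\<bar>"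
      by (simp add: power_int_def)
    finally show ?thesis by (simp add: power_int_abs)
  qed
qed auto

text \<open>Real summability over a set is absolute, so Fubini turns the product of two sums into
  one sum over the lattice, where variables can be changed freely.\<close>

lemma
  fixes f g :: "int \<Rightarrow> real"
  assumes "f summable_on UNIV" "g summable_on UNIV"
  shows summable_on_int_times: "(\<lambda>(m, n). f m * g n) summable_on UNIV"
    and infsum_int_times: "infsum f UNIV * infsum g UNIV = (\<Sum>\<^sub>\<infinity>(m, n). f m * g n)"
proof -
  have f: "(\<lambda>m. norm (f m)) summable_on UNIV"
    using assms(1) unfolding summable_on_iff_abs_summable_on_real[of f] .
  have g: "(\<lambda>n. norm (g n)) summable_on UNIV"
    using assms(2) unfolding summable_on_iff_abs_summable_on_real[of g] .
  have 1: "(\<lambda>n. norm (f m * g n)) summable_on UNIV" for m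
    using summable_on_cmult_right[OF g, of "norm (f m)"] by (simp add: abs_mult)
  have 2: "(\<lambda>m. norm (\<Sum>\<^sub>\<infinity>n. norm (f m * g n))) summable_on UNIV"
    using summable_on_cmult_left[OF f, of "infsum (\<lambda>n. norm (g n)) UNIV"]
    by (simp add: abs_mult infsum_cmult_right' infsum_nonneg)
  have "(\<lambda>x. norm (f (fst x) * g (snd x))) summable_on Sigma UNIV (\<lambda>_. UNIV)"
    using 1 2 Infinite_Sum.abs_summable_on_Sigma_iff[where f = "\<lambda>x. f (fst x) * g (snd x)" and A = UNIV and B = "\<lambda>_. UNIV"]
    by simp
  then have *: "(\<lambda>x. f (fst x) * g (snd x)) summable_on UNIV"
    using abs_summable_summable[of "\<lambda>x. f (fst x) * g (snd x)" UNIV] by simp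
  then show "(\<lambda>(m, n). f m * g n) summable_on UNIV"
    by (simp add: case_prod_unfold)
  have "(\<Sum>\<^sub>\<infinity>m. \<Sum>\<^sub>\<infinity>n. f m * g n) = (\<Sum>\<^sub>\<infinity>x. f (fst x) * g (snd x))"
    using infsum_Sigma_banach[of "\<lambda>x. f (fst x) * g (snd x)" UNIV "\<lambda>_. UNIV"] * by simp
  then show "infsum f UNIV * infsum g UNIV = (\<Sum>\<^sub>\<infinity>(m, n). f m * g n)"
    by (simp add: infsum_cmult_right' infsum_cmult_left' case_prod_unfold)
qed

section \<open>The theta series and their duplication and cubic identities\<close>

definition ramanujan_phi :: "real \<Rightarrow> real" where
  "ramanujan_phi q = (\<Sum>\<^sub>\<infinity>n::int. q powi (n * n))"

definition ramanujan_psi :: "real \<Rightarrow> real" where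
  "ramanujan_psi q = (\<Sum>n. q ^ (n * (n + 1) div 2))"

lemma summable_square_powi:
  fixes q :: real
  assumes "q \<noteq> 0" "\<bar>q\<bar> < 1"
  shows "(\<lambda>n::int. q powi (n * n)) summable_on UNIV"
proof (rule summable_on_int_powi[OF assms])
  show "\<bar>n\<bar> - 1 \<le> n * n" for n :: int
  proof (cases "n = 0")
    case False
    then have "\<bar>n\<bar> * 1 \<le> \<bar>n\<bar> * \<bar>n\<bar>" by (intro mult_left_mono) auto
    then show ?thesis by (simp only: abs_mult_self_eq)
  qed auto
qed

lemma int_triangular_le:
  fixes n :: int
  shows "\<bar>n\<bar> - 1 \<le> n * (n + 1) div 2"
proof -
  have "2 * \<bar>n\<bar> - 2 \<le> n * (n + 1)"
  proof (cases "n \<ge> 0")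
    case True
    then have "0 \<le> n * (n - 1)" by (cases "n = 0") auto
    with True show ?thesis by (simp add: algebra_simps)
  next
    case False
    then have "0 \<le> (n + 1) * (n + 2)"
      by (cases "n = -1") (auto intro: mult_nonpos_nonpos)
    with False show ?thesis by (simp add: algebra_simps)
  qed
  then show ?thesis by linarith
qed

lemma summable_triangular_powi:
  fixes q :: real
  assumes "q \<noteq> 0" "\<bar>q\<bar> < 1"
  shows "(\<lambda>n::int. q powi (n * (n + 1) div 2)) summable_on UNIV"
  using summable_on_int_powi[OF assms int_triangular_le] .

text \<open>The reflection n -> -1 - n fixes n(n + 1)/2 and exchanges the negative with the
  nonnegative integers, so each term of the one-sided series occurs twice.\<close>

lemma infsum_triangular_powi:
  fixes q :: real
  assumes "q \<noteq> 0" "\<bar>q\<bar> < 1"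
  shows "(\<Sum>\<^sub>\<infinity>n::int. q powi (n * (n + 1) div 2)) = 2 * ramanujan_psi q"
proof -
  define f where "f = (\<lambda>n::int. q powi (n * (n + 1) div 2))"
  have sm: "f summable_on A" for A
    using summable_on_subset_banach[OF summable_triangular_powi[OF assms]] unfolding f_def by blast
  have "infsum f UNIV = infsum f ({0..} \<union> {..<0})"
    by (rule arg_cong[where f = "infsum f"]) auto
  also have "\<dots> = infsum f {0..} + infsum f {..<0}"
    by (rule infsum_Un_disjoint) (auto intro: sm)
  also have "infsum f {..<0} = infsum f {0..}"
    by (rule infsum_reindex_bij_witness[of _ "\<lambda>n. -1 - n" "\<lambda>n. -1 - n"])
       (auto simp: f_def algebra_simps)
  also have "infsum f {0..} = infsum (\<lambda>n. f (int n)) UNIV"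
    by (rule infsum_reindex_bij_witness[of _ int nat]) auto
  also have "(\<lambda>n. f (int n)) = (\<lambda>n. q ^ (n * (n + 1) div 2))"
  proof
    fix n
    have "int n * (int n + 1) div 2 = int (n * (n + 1) div 2)"
      by (simp add: zdiv_int algebra_simps)
    then show "f (int n) = q ^ (n * (n + 1) div 2)" unfolding f_def by (simp only: power_int_of_nat)
  qed
  also have "infsum (\<lambda>n. q ^ (n * (n + 1) div 2)) UNIV = ramanujan_psi q"
  proof -
    have "(\<lambda>n. f (int n)) summable_on UNIV"
      using sm[of "range int"] summable_on_reindex[of int UNIV f] by (simp add: o_def)
    then have "(\<lambda>n. q ^ (n * (n + 1) div 2)) summable_on UNIV"
      unfolding \<open>(\<lambda>n. f (int n)) = _\<close> .
    from has_sum_imp_sums[OF has_sum_infsum[OF this]] show ?thesis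
      unfolding ramanujan_psi_def by (simp add: sums_iff)
  qed
  finally show ?thesis unfolding f_def by simp
qed

lemma infsum_pronic_powi:
  fixes q :: real
  assumes "q \<noteq> 0" "\<bar>q\<bar> < 1"
  shows "(\<lambda>n::int. q powi (n * (n + 1))) summable_on UNIV"
    and "(\<Sum>\<^sub>\<infinity>n::int. q powi (n * (n + 1))) = 2 * ramanujan_psi (q\<^sup>2)"
proof -
  have *: "(\<lambda>n::int. (q\<^sup>2) powi (n * (n + 1) div 2)) = (\<lambda>n. q powi (n * (n + 1)))"
  proof
    fix n :: int
    have "(q\<^sup>2) powi (n * (n + 1) div 2) = q powi (2 * (n * (n + 1) div 2))"
      using power_int_mult[of q 2 "n * (n + 1) div 2"] by simp
    also have "2 * (n * (n + 1) div 2) = n * (n + 1)" by auto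
    finally show "(q\<^sup>2) powi (n * (n + 1) div 2) = q powi (n * (n + 1))" .
  qed
  have q2: "q\<^sup>2 \<noteq> 0" "\<bar>q\<^sup>2\<bar> < 1"
    using assms by (auto simp: abs_square_less_1)
  from summable_triangular_powi[OF q2] show "(\<lambda>n::int. q powi (n * (n + 1))) summable_on UNIV"
    unfolding * .
  from infsum_triangular_powi[OF q2] show "(\<Sum>\<^sub>\<infinity>n::int. q powi (n * (n + 1))) = 2 * ramanujan_psi (q\<^sup>2)"
    unfolding * .
qed

text \<open>Negating both arguments multiplies the term of index (m, n) by (-1)^(m + n). Sum and
  difference of the two products therefore isolate the two parity classes; c = 1 gives the
  duplication formulas and c = 3 the cubic identity.\<close>

lemma phi_mult_eq:
  fixes q :: real and c :: nat
  assumes "q \<noteq> 0" "\<bar>q\<bar> < 1" "odd c"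
  defines "f \<equiv> (\<lambda>(m::int, n::int). q powi (m * m + int c * (n * n)))"
  shows "f summable_on A"
    and "ramanujan_phi q * ramanujan_phi (q ^ c) = infsum f {(m, n). even (m + n)} + infsum f {(m, n). odd (m + n)}"
    and "ramanujan_phi (- q) * ramanujan_phi (- (q ^ c)) = infsum f {(m, n). even (m + n)} - infsum f {(m, n). odd (m + n)}"
proof -
  have qc: "q ^ c \<noteq> 0" "\<bar>q ^ c\<bar> < 1"
    using assms by (auto simp: power_abs power_less_one_iff dest: odd_pos)
  have f1: "(\<lambda>(m, n). q powi (m * m) * (q ^ c) powi (n * n)) = f"
    using assms(1) by (auto simp: f_def power_int_add power_int_mult fun_eq_iff)
  define s where "s = (\<lambda>(m::int, n::int). (- 1 :: real) powi (m + n))"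
  have f2: "(\<lambda>(m, n). (- q) powi (m * m) * (- (q ^ c)) powi (n * n)) = (\<lambda>x. s x * f x)"
  proof (intro ext, clarify)
    fix m n :: int
    have "(- q) powi (m * m) = (-1) powi m * q powi (m * m)" for q :: real and m :: int
      by (cases "even m") (auto simp: power_int_minus_left)
    then show "(- q) powi (m * m) * (- (q ^ c)) powi (n * n) = s (m, n) * f (m, n)"
      using fun_cong[OF f1, of "(m, n)"] by (simp add: s_def power_int_add)
  qed
  note sm = summable_square_powi
  have f: "f summable_on A" for A
    using summable_on_subset_banach[OF summable_on_int_times[OF sm[OF assms(1,2)] sm[OF qc]]]
    unfolding f1 by blast
  then show "f summable_on A" .
  have sf: "(\<lambda>x. s x * f x) summable_on A" for A
    using summable_on_subset_banach[OF summable_on_int_times[OF sm[of "- q"] sm[of "- (q ^ c)"]]] assms(1,2) qc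
    unfolding f2 by auto
  have U: "UNIV = {(m, n). even (m + n)} \<union> {(m::int, n::int). odd (m + n)}" by auto
  have disj: "{(m, n). even (m + n)} \<inter> {(m::int, n::int). odd (m + n)} = {}" by auto
  show "ramanujan_phi q * ramanujan_phi (q ^ c) = infsum f {(m, n). even (m + n)} + infsum f {(m, n). odd (m + n)}"
    unfolding ramanujan_phi_def infsum_int_times[OF sm[OF assms(1,2)] sm[OF qc]] f1
    by (subst U, rule infsum_Un_disjoint) (use f disj in auto)
  have "ramanujan_phi (- q) * ramanujan_phi (- (q ^ c)) = infsum (\<lambda>x. s x * f x) UNIV"
    unfolding ramanujan_phi_def using infsum_int_times[OF sm[of "- q"] sm[of "- (q ^ c)"]] assms(1,2) qc
    unfolding f2 by simp
  also have "\<dots> = infsum (\<lambda>x. s x * f x) {(m, n). even (m + n)} + infsum (\<lambda>x. s x * f x) {(m, n). odd (m + n)}"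
    by (subst U, rule infsum_Un_disjoint) (use sf disj in auto)
  also have "infsum (\<lambda>x. s x * f x) {(m, n). even (m + n)} = infsum f {(m, n). even (m + n)}"
    by (rule infsum_cong) (auto simp: s_def power_int_minus_left)
  also have "infsum (\<lambda>x. s x * f x) {(m, n). odd (m + n)} = infsum (\<lambda>x. - f x) {(m, n). odd (m + n)}"
    by (rule infsum_cong) (auto simp: s_def power_int_minus_left)
  also have "\<dots> = - infsum f {(m, n). odd (m + n)}"
    by (rule infsum_uminus)
  finally show "ramanujan_phi (- q) * ramanujan_phi (- (q ^ c)) = infsum f {(m, n). even (m + n)} - infsum f {(m, n). odd (m + n)}"
    by simp
qed

text \<open>Pairs with m + n even are m = u + v, n = u - v, and then m^2 + n^2 = 2 u^2 + 2
  v^2.\<close>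

lemma phi_square_add:
  fixes q :: real
  assumes "q \<noteq> 0" "\<bar>q\<bar> < 1"
  shows "(ramanujan_phi q)\<^sup>2 + (ramanujan_phi (- q))\<^sup>2 = 2 * (ramanujan_phi (q\<^sup>2))\<^sup>2"
proof -
  have q2: "q\<^sup>2 \<noteq> 0" "\<bar>q\<^sup>2\<bar> < 1"
    using assms by (auto simp: abs_square_less_1)
  let ?f = "\<lambda>(m::int, n::int). q powi (m * m + int 1 * (n * n))"
  have "(ramanujan_phi (q\<^sup>2))\<^sup>2 = (\<Sum>\<^sub>\<infinity>(u::int, v::int). (q\<^sup>2) powi (u * u) * (q\<^sup>2) powi (v * v))"
    unfolding power2_eq_square[of "ramanujan_phi _"]
    unfolding ramanujan_phi_def
    by (rule infsum_int_times[OF summable_square_powi[OF q2] summable_square_powi[OF q2]])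
  also have "\<dots> = infsum ?f {(m, n). even (m + n)}"
  proof (rule infsum_reindex_bij_witness[of _ "\<lambda>(m, n). ((m + n) div 2, (m - n) div 2)" "\<lambda>(u, v). (u + v, u - v)"])
    fix a :: "int \<times> int"
    obtain u v where a: "a = (u, v)" by (cases a)
    have "(q\<^sup>2) powi (u * u) * (q\<^sup>2) powi (v * v) = q powi (2 * (u * u) + 2 * (v * v))"
      using assms by (simp add: power_int_mult power_int_add)
    also have "2 * (u * u) + 2 * (v * v) = (u + v) * (u + v) + int 1 * ((u - v) * (u - v))"
      by (simp add: algebra_simps)
    finally show "?f (case a of (u, v) \<Rightarrow> (u + v, u - v)) = (case a of (u, v) \<Rightarrow> (q\<^sup>2) powi (u * u) * (q\<^sup>2) powi (v * v))"
      by (simp add: a)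
  qed (auto, presburger+)
  finally show ?thesis
    using phi_mult_eq(2,3)[of q 1] assms by (simp add: power2_eq_square)
qed

text \<open>Pairs with m + n odd are m = u + v + 1, n = u - v, and then m^2 + n^2 = 1 + 2u(u + 1) +
  2v(v + 1).\<close>

lemma phi_square_diff:
  fixes q :: real
  assumes "q \<noteq> 0" "\<bar>q\<bar> < 1"
  shows "(ramanujan_phi q)\<^sup>2 - (ramanujan_phi (- q))\<^sup>2 = 8 * q * (ramanujan_psi (q ^ 4))\<^sup>2"
proof -
  have q2: "q\<^sup>2 \<noteq> 0" "\<bar>q\<^sup>2\<bar> < 1"
    using assms by (auto simp: abs_square_less_1)
  let ?f = "\<lambda>(m::int, n::int). q powi (m * m + int 1 * (n * n))"
  have "q * (2 * ramanujan_psi ((q\<^sup>2)\<^sup>2))\<^sup>2 = q * (\<Sum>\<^sub>\<infinity>(u::int, v::int). (q\<^sup>2) powi (u * (u + 1)) * (q\<^sup>2) powi (v * (v + 1)))"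
    unfolding power2_eq_square[of "_ * ramanujan_psi _"]
    unfolding infsum_pronic_powi(2)[OF q2, symmetric]
    unfolding infsum_int_times[OF infsum_pronic_powi(1)[OF q2] infsum_pronic_powi(1)[OF q2]] ..
  also have "\<dots> = (\<Sum>\<^sub>\<infinity>(u::int, v::int). q * ((q\<^sup>2) powi (u * (u + 1)) * (q\<^sup>2) powi (v * (v + 1))))"
    by (subst infsum_cmult_right' [symmetric]) (simp add: case_prod_unfold)
  also have "\<dots> = infsum ?f {(m, n). odd (m + n)}"
  proof (rule infsum_reindex_bij_witness[of _ "\<lambda>(m, n). ((m + n - 1) div 2, (m - n - 1) div 2)" "\<lambda>(u, v). (u + v + 1, u - v)"])
    fix a :: "int \<times> int"
    obtain u v where a: "a = (u, v)" by (cases a)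
    have "q * ((q\<^sup>2) powi (u * (u + 1)) * (q\<^sup>2) powi (v * (v + 1))) = q powi (1 + (2 * (u * (u + 1)) + 2 * (v * (v + 1))))"
      using assms by (simp add: power_int_mult power_int_add)
    also have "1 + (2 * (u * (u + 1)) + 2 * (v * (v + 1))) = (u + v + 1) * (u + v + 1) + int 1 * ((u - v) * (u - v))"
      by (simp add: algebra_simps)
    finally show "?f (case a of (u, v) \<Rightarrow> (u + v + 1, u - v)) = (case a of (u, v) \<Rightarrow> q * ((q\<^sup>2) powi (u * (u + 1)) * (q\<^sup>2) powi (v * (v + 1))))"
      by (simp add: a)
  qed (auto, presburger+)
  finally show ?thesis
    using phi_mult_eq(2,3)[of q 1] assms by (simp add: power2_eq_square power4_eq_xxxx mult_ac)
qed

text \<open>Reflecting the second index by n -> -1 - n changes the parity of m + n, so both parity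
  classes contribute equally.\<close>

lemma infsum_int_times_split:
  fixes f g :: "int \<Rightarrow> real"
  assumes "f summable_on UNIV" "g summable_on UNIV" "\<And>n. g (- 1 - n) = g n"
  shows "infsum f UNIV * infsum g UNIV = 2 * (\<Sum>\<^sub>\<infinity>(m, n)\<in>{(m, n). even (m + n)}. f m * g n)"
proof -
  define h where "h = (\<lambda>(m, n). f m * g n)"
  have sm: "h summable_on A" for A
    using summable_on_subset_banach[OF summable_on_int_times[OF assms(1,2)]] unfolding h_def by blast
  have "UNIV = {(m, n). even (m + n)} \<union> {(m::int, n::int). odd (m + n)}" by auto
  then have "infsum h UNIV = infsum h ({(m, n). even (m + n)} \<union> {(m::int, n::int). odd (m + n)})"
    by simp
  also have "\<dots> = infsum h {(m, n). even (m + n)} + infsum h {(m, n). odd (m + n)}"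
    by (rule infsum_Un_disjoint) (auto intro: sm)
  also have "infsum h {(m, n). odd (m + n)} = infsum h {(m, n). even (m + n)}"
    by (rule infsum_reindex_bij_witness[of _ "\<lambda>(m, n). (m, -1 - n)" "\<lambda>(m, n). (m, -1 - n)"])
       (auto simp: h_def assms(3))
  finally show ?thesis
    unfolding infsum_int_times[OF assms(1,2)] h_def by simp
qed

text \<open>In the even half of the double sum for \<psi>(q)^2, put m = v + u and n = v - u: the two
  triangular exponents add up to u^2 + v(v + 1).\<close>

lemma phi_psi:
  fixes q :: real
  assumes "q \<noteq> 0" "\<bar>q\<bar> < 1"
  shows "ramanujan_phi q * ramanujan_psi (q\<^sup>2) = (ramanujan_psi q)\<^sup>2"
proof -
  have refl: "q powi ((- 1 - n) * (- 1 - n + 1) div 2) = q powi (n * (n + 1) div 2)" for n :: int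
    by (simp add: algebra_simps)
  let ?e = "\<lambda>(u::int, v::int). q powi (u * u) * q powi (v * (v + 1))"
  have "(2 * ramanujan_psi q)\<^sup>2 =
    2 * (\<Sum>\<^sub>\<infinity>(m, n)\<in>{(m, n). even (m + n)}. q powi (m * (m + 1) div 2) * q powi (n * (n + 1) div 2))"
    unfolding power2_eq_square infsum_triangular_powi[OF assms, symmetric]
    by (rule infsum_int_times_split[OF summable_triangular_powi[OF assms] summable_triangular_powi[OF assms] refl])
  also have "(\<Sum>\<^sub>\<infinity>(m, n)\<in>{(m, n). even (m + n)}. q powi (m * (m + 1) div 2) * q powi (n * (n + 1) div 2)) =
    infsum ?e UNIV"
  proof (rule infsum_reindex_bij_witness[of _ "\<lambda>(u, v). (v + u, v - u)" "\<lambda>(m, n). ((m - n) div 2, (m + n) div 2)"])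
    fix a :: "int \<times> int"
    assume "a \<in> {(m, n). even (m + n)}"
    then obtain m n where a: "a = (m, n)" and "even (m + n)" by auto
    from this(2) obtain k where k: "m + n = 2 * k" by (rule evenE)
    then have n: "n = 2 * k - m" by simp
    have "m * (m + 1) div 2 + n * (n + 1) div 2 = (m * (m + 1) + n * (n + 1)) div 2"
      by (rule div_plus_div_distrib_dvd_left[symmetric]) auto
    also have "m * (m + 1) + n * (n + 1) = 2 * ((m - k) * (m - k) + k * (k + 1))"
      by (simp add: n algebra_simps)
    finally have *: "m * (m + 1) div 2 + n * (n + 1) div 2 = (m - k) * (m - k) + k * (k + 1)"
      by simp
    have "q powi (m * (m + 1) div 2) * q powi (n * (n + 1) div 2) = q powi ((m - k) * (m - k)) * q powi (k * (k + 1))"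
      unfolding power_int_add[OF disjI1[OF assms(1)], symmetric] * ..
    moreover have "(m - n) div 2 = m - k" unfolding n by simp
    ultimately show "?e (case a of (m, n) \<Rightarrow> ((m - n) div 2, (m + n) div 2)) =
       (case a of (m, n) \<Rightarrow> q powi (m * (m + 1) div 2) * q powi (n * (n + 1) div 2))"
      by (simp add: a k)
  qed (auto, presburger+)
  also have "infsum ?e UNIV = ramanujan_phi q * (2 * ramanujan_psi (q\<^sup>2))"
    unfolding ramanujan_phi_def infsum_pronic_powi(2)[OF assms, symmetric]
    by (rule infsum_int_times[OF summable_square_powi[OF assms] infsum_pronic_powi(1)[OF assms], symmetric])
  finally show ?thesis by (simp add: power2_eq_square)
qed

text \<open>The left side is twice the odd part of the sum of q^(u^2 + 3 v^2). The right side is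
  matched with it by a linear substitution preserving the form A^2 + 3 B^2 up to a constant.\<close>

lemma phi_cubic:
  fixes q :: real
  assumes "q \<noteq> 0" "\<bar>q\<bar> < 1"
  shows "ramanujan_phi q * ramanujan_phi (q ^ 3) - ramanujan_phi (- q) * ramanujan_phi (- (q ^ 3)) =
    4 * q * ramanujan_psi (q\<^sup>2) * ramanujan_psi (q ^ 6)"
proof -
  have q3: "q ^ 3 \<noteq> 0" "\<bar>q ^ 3\<bar> < 1"
    using assms by (auto simp: power_abs power_less_one_iff)
  have refl: "(q ^ 3) powi ((- 1 - n) * (- 1 - n + 1)) = (q ^ 3) powi (n * (n + 1))" for n :: int
    by (simp add: algebra_simps)
  let ?f = "\<lambda>(m::int, n::int). q powi (m * m + int 3 * (n * n))"
  let ?S = "(\<Sum>\<^sub>\<infinity>(m, n)\<in>{(m, n). even (m + n)}. q powi (m * (m + 1)) * (q ^ 3) powi (n * (n + 1)))"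
  have "(2 * ramanujan_psi (q\<^sup>2)) * (2 * ramanujan_psi ((q ^ 3)\<^sup>2)) = 2 * ?S"
    unfolding infsum_pronic_powi(2)[OF assms, symmetric] infsum_pronic_powi(2)[OF q3, symmetric]
    by (rule infsum_int_times_split[OF infsum_pronic_powi(1)[OF assms] infsum_pronic_powi(1)[OF q3] refl])
  then have S: "q * ?S = 2 * q * ramanujan_psi (q\<^sup>2) * ramanujan_psi (q ^ 6)"
    by (simp add: power_mult [symmetric])
  have "q * ?S = (\<Sum>\<^sub>\<infinity>(m, n)\<in>{(m, n). even (m + n)}. q * (q powi (m * (m + 1)) * (q ^ 3) powi (n * (n + 1))))"
    by (subst infsum_cmult_right' [symmetric]) (simp add: case_prod_unfold)
  also have "\<dots> = infsum ?f {(m, n). odd (m + n)}"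
  \<comment> \<open>With A = 2a + 1 and B = 2b + 1 the substitution is u = (A + 3B)/4, v = (A -
    B)/4. It comes from (A + 3B)^2 + 3 (A - B)^2 = 4 (A^2 + 3 B^2), and it is integral exactly when
    a + b is even.\<close>
  proof (rule infsum_reindex_bij_witness[of _ "\<lambda>(u, v). ((u - v - 1) div 2 + 2 * v, (u - v - 1) div 2)" "\<lambda>(a, b). (2 * b + (a - b) div 2 + 1, (a - b) div 2)"])
    fix x :: "int \<times> int"
    assume "x \<in> {(m, n). even (m + n)}"
    then obtain a b where x: "x = (a, b)" and "even (a + b)" by auto
    then have "even (a - b)" by simp
    then obtain v where "a - b = 2 * v" by (rule evenE)
    then have a: "a = b + 2 * v" by simp
    have "q * (q powi (a * (a + 1)) * (q ^ 3) powi (b * (b + 1))) = q powi (1 + (a * (a + 1) + 3 * (b * (b + 1))))"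
      using assms by (simp add: power_int_mult power_int_add)
    also have "1 + (a * (a + 1) + 3 * (b * (b + 1))) = (2 * b + v + 1) * (2 * b + v + 1) + int 3 * (v * v)"
      by (simp add: a algebra_simps)
    finally show "?f (case x of (a, b) \<Rightarrow> (2 * b + (a - b) div 2 + 1, (a - b) div 2)) =
       (case x of (m, n) \<Rightarrow> q * (q powi (m * (m + 1)) * (q ^ 3) powi (n * (n + 1))))"
      by (simp add: x a)
    show "(case case x of (a, b) \<Rightarrow> (2 * b + (a - b) div 2 + 1, (a - b) div 2) of
         (u, v) \<Rightarrow> ((u - v - 1) div 2 + 2 * v, (u - v - 1) div 2)) = x"
      by (simp add: x a)
    show "(case x of (a, b) \<Rightarrow> (2 * b + (a - b) div 2 + 1, (a - b) div 2)) \<in> {(m, n). odd (m + n)}"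
      by (simp add: x a)
  next
    fix x :: "int \<times> int"
    assume "x \<in> {(m, n). odd (m + n)}"
    then obtain u v where x: "x = (u, v)" and "odd (u + v)" by auto
    then have "even (u - v - 1)" by simp
    then obtain b where "u - v - 1 = 2 * b" by (rule evenE)
    then have u: "u = 2 * b + v + 1" by simp
    show "(case case x of (u, v) \<Rightarrow> ((u - v - 1) div 2 + 2 * v, (u - v - 1) div 2) of
         (a, b) \<Rightarrow> (2 * b + (a - b) div 2 + 1, (a - b) div 2)) = x"
      by (simp add: x u)
    show "(case x of (u, v) \<Rightarrow> ((u - v - 1) div 2 + 2 * v, (u - v - 1) div 2)) \<in> {(m, n). even (m + n)}"
      by (simp add: x u)
  qed
  finally show ?thesis
    using phi_mult_eq(2,3)[of q 3] assms S by (simp add: power2_eq_square)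
qed

section \<open>Product expansions\<close>

lemma convergent_prod_one_minus_power:
  fixes q :: real and a :: "nat \<Rightarrow> nat"
  assumes "\<bar>q\<bar> < 1" "\<And>k. k \<le> a k"
  shows "convergent_prod (\<lambda>k. 1 - q ^ a k)"
proof (rule abs_convergent_prod_imp_convergent_prod, rule summable_imp_abs_convergent_prod)
  show "summable (\<lambda>k. norm (1 - q ^ a k - 1))"
  proof (rule summable_comparison_test')
    show "summable (\<lambda>k. \<bar>q\<bar> ^ k)" using assms by (intro summable_geometric) auto
    show "norm (norm (1 - q ^ a k - 1)) \<le> \<bar>q\<bar> ^ k" for k
      using assms by (auto simp: power_abs intro!: power_decreasing)
  qed
qed

lemma prod_LIMSEQ_prodinf:
  fixes f :: "nat \<Rightarrow> real"
  assumes "convergent_prod f"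
  shows "(\<lambda>n. \<Prod>k<n. f k) \<longlonglongrightarrow> prodinf f"
  using has_prod_imp_tendsto'[OF convergent_prod_has_prod[OF assms]] .

text \<open>This is (q; q^2)_inf, equal to f(-q) / f(-q^2), the quotient occurring in the class
  invariant.\<close>

definition odd_qprod :: "real \<Rightarrow> real" where
  "odd_qprod q = (\<Prod>k. 1 - q ^ (2 * k + 1))"

lemma one_minus_power_pos:
  fixes q :: real
  assumes "\<bar>q\<bar> < 1" "0 < k"
  shows "0 < 1 - q ^ k"
proof -
  have "q ^ k \<le> \<bar>q\<bar> ^ k" by (metis abs_ge_self power_abs)
  also have "\<dots> < 1" using assms by (simp add: power_less_one_iff)
  finally show ?thesis by simp
qed

lemma odd_qprod_pos: "\<bar>q\<bar> < 1 \<Longrightarrow> 0 < odd_qprod q"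
  unfolding odd_qprod_def
  by (intro less_0_prodinf convergent_prod_one_minus_power one_minus_power_pos) auto

lemma qpochhammer_self_eq: "qpochhammer_inf q q = (\<Prod>k. 1 - q ^ (k + 1))"
  by (simp add: qpochhammer_inf_def)

lemma qpochhammer_self_pos: "\<bar>q\<bar> < 1 \<Longrightarrow> 0 < qpochhammer_inf q q"
  unfolding qpochhammer_self_eq
  by (intro less_0_prodinf convergent_prod_one_minus_power one_minus_power_pos) auto

text \<open>The factors 1 - q^j are sorted by the parity of j in the partial products of even
  length, before passing to the limit.\<close>

lemma qpochhammer_self_split:
  assumes "\<bar>q\<bar> < 1"
  shows "qpochhammer_inf q q = qpochhammer_inf (q\<^sup>2) (q\<^sup>2) * odd_qprod q"
proof (rule LIMSEQ_unique)
  have fin: "(\<Prod>k<2 * n. 1 - q ^ (k + 1)) = (\<Prod>k<n. 1 - (q\<^sup>2) ^ (k + 1)) * (\<Prod>k<n. 1 - q ^ (2 * k + 1))" for n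
  proof (induction n)
    case (Suc n)
    have "q ^ (2 * n + 1 + 1) = (q\<^sup>2) ^ (n + 1)"
      unfolding power_mult [symmetric] by simp
    with Suc show ?case by (simp add: mult_ac)
  qed simp
  have "(\<lambda>n. \<Prod>k<n. 1 - q ^ (k + 1)) \<longlonglongrightarrow> qpochhammer_inf q q"
    unfolding qpochhammer_self_eq
    by (intro prod_LIMSEQ_prodinf convergent_prod_one_minus_power assms) auto
  then show "(\<lambda>n. \<Prod>k<2 * n. 1 - q ^ (k + 1)) \<longlonglongrightarrow> qpochhammer_inf q q"
    by (rule LIMSEQ_subseq_LIMSEQ[unfolded o_def]) (auto simp: strict_mono_def)
  have q2: "\<bar>q\<^sup>2\<bar> < 1" using assms by (simp add: abs_square_less_1)
  show "(\<lambda>n. \<Prod>k<2 * n. 1 - q ^ (k + 1)) \<longlonglongrightarrow> qpochhammer_inf (q\<^sup>2) (q\<^sup>2) * odd_qprod q"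
    unfolding fin qpochhammer_self_eq odd_qprod_def
    by (intro tendsto_mult prod_LIMSEQ_prodinf convergent_prod_one_minus_power assms q2) auto
qed

lemma odd_qprod_minus:
  assumes "\<bar>q\<bar> < 1"
  shows "odd_qprod q * odd_qprod (- q) = odd_qprod (q\<^sup>2)"
proof -
  have "(1 - q ^ (2 * k + 1)) * (1 - (- q) ^ (2 * k + 1)) = 1 - (q\<^sup>2) ^ (2 * k + 1)" for k
    by (simp add: power_mult [symmetric] algebra_simps power_add [symmetric])
  moreover have "odd_qprod q * odd_qprod (- q) = (\<Prod>k. (1 - q ^ (2 * k + 1)) * (1 - (- q) ^ (2 * k + 1)))"
    unfolding odd_qprod_def using assms by (intro prodinf_mult convergent_prod_one_minus_power) auto
  ultimately show ?thesis unfolding odd_qprod_def by simp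
qed

section \<open>Gauss's product for \<psi> and the product for \<phi>\<close>

text \<open>Shanks's finite form of Gauss's identity; as \<open>n\<close> grows, only the summand \<open>s = 0\<close> survives on the left.\<close>
lemma shanks_triangular:
  fixes q :: real
  assumes "\<bar>q\<bar> < 1"
  defines "p \<equiv> (\<lambda>n. \<Prod>k<n. (1 - q ^ (2 * k + 2)) / (1 - q ^ (2 * k + 1)))"
  shows "(\<Sum>s<n. p n / p s * q ^ (s * (2 * n + 1))) = (\<Sum>j<2 * n. q ^ (j * (j + 1) div 2))"
proof (induction n)
  case (Suc n)
  have nz: "1 - q ^ k \<noteq> 0" if "0 < k" for k
    using one_minus_power_pos[OF assms(1) that] by simp
  have pSuc: "p (Suc k) = p k * ((1 - q ^ (2 * k + 2)) / (1 - q ^ (2 * k + 1)))" for k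
    by (simp add: p_def)
  have pnz: "p k \<noteq> 0" for k
    unfolding p_def using nz by (auto simp: prod_zero_iff simp del: power_Suc)
  \<comment> \<open>\<open>V\<close> is the telescoping certificate: raising n by one changes the
    summand of index s by \<open>V (Suc s) - V s\<close>.\<close>
  define V where "V = (\<lambda>s. p n / p s * q ^ (s * (2 * n + 1)) * (1 - q ^ (2 * s)) / (1 - q ^ (2 * n + 1)))"
  have step: "p (Suc n) / p s * q ^ (s * (2 * Suc n + 1)) = p n / p s * q ^ (s * (2 * n + 1)) + (V (Suc s) - V s)" for s
  proof -
    define x y z where "x = q ^ (2 * s)" and "y = q ^ (2 * n + 1)" and "z = q ^ (s * (2 * n + 1))"
    have y: "1 - y \<noteq> 0" using nz[of "2 * n + 1"] by (simp add: y_def)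
    have x: "1 - q * x \<noteq> 0" "1 - q * q * x \<noteq> 0"
      using nz[of "2 * s + 1"] nz[of "2 * s + 2"] by (simp_all add: x_def mult_ac)
    have e: "q ^ (s * (2 * Suc n + 1)) = z * x" "q ^ (2 * n + 2) = q * y" "q ^ (Suc s * (2 * n + 1)) = z * y"
        "q ^ (2 * Suc s) = q * q * x"
      by (simp_all add: x_def y_def z_def algebra_simps flip: power_add power_Suc)
    have e': "q ^ (2 * s + 2) = q * q * x" "q ^ (2 * s + 1) = q * x"
      by (simp_all add: x_def)
    have "p (Suc n) / p s * q ^ (s * (2 * Suc n + 1)) = p n / p s * ((1 - q * y) * (z * x)) / (1 - y)"
      unfolding e pSuc by (simp add: y_def mult_ac)
    \<comment> \<open>With x = q^(2s) and y = q^(2n + 1) the telescoping reduces to this polynomial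
      identity.\<close>
    also have "(1 - q * y) * (z * x) = z * (1 - y) + ((1 - q * x) * (z * y) - z * (1 - x))"
      by (simp add: algebra_simps)
    also have "p n / p s * \<dots> / (1 - y) = p n / p s * z + (p n / p s * (1 - q * x) * (z * y) / (1 - y) - p n / p s * z * (1 - x) / (1 - y))"
    proof -
      have "c * (w * d + (A - B)) / d = c * w + (c * A / d - c * B / d)" if "d \<noteq> 0" for c w d A B :: real
        using that by (simp add: field_simps)
      from this[OF y] show ?thesis by (simp only: mult.assoc)
    qed
    also have "p n / p s * (1 - q * x) * (z * y) / (1 - y) = V (Suc s)"
      unfolding V_def e pSuc e' y_def[symmetric] using x pnz[of s] by simp
    also have "p n / p s * z * (1 - x) / (1 - y) = V s"
      unfolding V_def x_def y_def z_def ..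
    finally show ?thesis unfolding z_def .
  qed
  \<comment> \<open>Two new powers appear: the summand s = n at the old level and the boundary value
    \<open>V (Suc n)\<close>. Their exponents are the triangular numbers of index 2n and 2n +
    1.\<close>
  have "(\<Sum>s<Suc n. p (Suc n) / p s * q ^ (s * (2 * Suc n + 1))) =
    (\<Sum>s<Suc n. p n / p s * q ^ (s * (2 * n + 1))) + (\<Sum>s<Suc n. V (Suc s) - V s)"
    unfolding step sum.distrib ..
  also have "(\<Sum>s<Suc n. V (Suc s) - V s) = V (Suc n) - V 0"
    by (rule sum_lessThan_telescope)
  also have "V (Suc n) = q ^ (Suc n * (2 * n + 1))"
    unfolding V_def pSuc using pnz[of n] nz[of "2 * n + 1"] nz[of "2 * n + 2"] by simp
  also have "V 0 = 0" by (simp add: V_def)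
  also have "(\<Sum>s<Suc n. p n / p s * q ^ (s * (2 * n + 1))) =
     (\<Sum>j<2 * n. q ^ (j * (j + 1) div 2)) + q ^ (n * (2 * n + 1))"
    using Suc.IH pnz[of n] by simp
  also have "\<dots> + (q ^ (Suc n * (2 * n + 1)) - 0) = (\<Sum>j<2 * Suc n. q ^ (j * (j + 1) div 2))"
  proof -
    have "2 * n * (2 * n + 1) div 2 = n * (2 * n + 1)" by simp
    moreover have "Suc (2 * n) * (Suc (2 * n) + 1) = 2 * (Suc n * (2 * n + 1))"
      by (simp add: algebra_simps)
    then have "Suc (2 * n) * (Suc (2 * n) + 1) div 2 = Suc n * (2 * n + 1)" by simp
    moreover have "2 * Suc n = Suc (Suc (2 * n))" by simp
    ultimately show ?thesis by (simp only: sum.lessThan_Suc diff_zero)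
  qed
  finally show ?case .
qed auto

text \<open>The limit of \<open>shanks_triangular\<close>: the quotients \<open>p n\<close> tend to
  the product on the right, and the summand s = 0 equals \<open>p n\<close>.\<close>

lemma psi_product:
  fixes q :: real
  assumes q: "\<bar>q\<bar> < 1"
  shows "ramanujan_psi q = qpochhammer_inf (q\<^sup>2) (q\<^sup>2) / odd_qprod q"
proof -
  define p where "p = (\<lambda>n. \<Prod>k<n. (1 - q ^ (2 * k + 2)) / (1 - q ^ (2 * k + 1)))"
  define L where "L = qpochhammer_inf (q\<^sup>2) (q\<^sup>2) / odd_qprod q"
  have q2: "\<bar>q\<^sup>2\<bar> < 1" using q by (simp add: abs_square_less_1)
  have L: "L \<noteq> 0"
    using qpochhammer_self_pos[OF q2] odd_qprod_pos[OF q] by (simp add: L_def)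
  have p_eq: "p = (\<lambda>n. (\<Prod>k<n. 1 - (q\<^sup>2) ^ (k + 1)) / (\<Prod>k<n. 1 - q ^ (2 * k + 1)))"
  proof -
    have "(q\<^sup>2) ^ (k + 1) = q ^ (2 * k + 2)" for k
      unfolding power_mult [symmetric] by simp
    then show ?thesis unfolding p_def prod_dividef by presburger
  qed
  have pL: "p \<longlonglongrightarrow> L"
    unfolding p_eq L_def odd_qprod_def qpochhammer_self_eq
    using odd_qprod_pos[OF q] unfolding odd_qprod_def
    by (intro tendsto_divide prod_LIMSEQ_prodinf convergent_prod_one_minus_power q q2) auto
  have "(\<lambda>n. inverse (p n)) \<longlonglongrightarrow> inverse L"
    by (rule tendsto_inverse[OF pL L])
  then have "Bseq (\<lambda>n. inverse (p n))"
    by (intro convergent_imp_Bseq) (auto simp: convergent_def)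
  then obtain C where C: "C > 0" "\<And>s. norm (inverse (p s)) \<le> C"
    by (auto elim: BseqE)
  \<comment> \<open>The summands with s \<ge> 1, with \<open>p n\<close> taken out. There are fewer
    than n of them when n > 0, each at most C |q|^n because s(2n + 1) \<ge> n.\<close>
  define e where "e = (\<lambda>n. \<Sum>s\<in>{1..<n}. inverse (p s) * q ^ (s * (2 * n + 1)))"
  have "e \<longlonglongrightarrow> 0"
  proof (rule Lim_null_comparison)
    show "\<forall>\<^sub>F n in sequentially. norm (e n) \<le> C * (real n * \<bar>q\<bar> ^ n)"
    proof (intro always_eventually allI)
      fix n
      have "norm (e n) \<le> (\<Sum>s\<in>{1..<n}. norm (inverse (p s) * q ^ (s * (2 * n + 1))))"
        unfolding e_def by (rule norm_sum)
      also have "\<dots> \<le> (\<Sum>s\<in>{1..<n}. C * \<bar>q\<bar> ^ n)"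
      proof (rule sum_mono)
        fix s assume "s \<in> {1..<n}"
        then have "1 * n \<le> s * (2 * n + 1)" by (intro mult_mono) auto
        then have "\<bar>q\<bar> ^ (s * (2 * n + 1)) \<le> \<bar>q\<bar> ^ n"
          using q by (intro power_decreasing) auto
        then show "norm (inverse (p s) * q ^ (s * (2 * n + 1))) \<le> C * \<bar>q\<bar> ^ n"
          unfolding norm_mult norm_power using C by (intro mult_mono) auto
      qed
      also have "\<dots> \<le> C * (real n * \<bar>q\<bar> ^ n)"
        using C(1) by (simp add: mult_right_mono)
      finally show "norm (e n) \<le> C * (real n * \<bar>q\<bar> ^ n)" .
    qed
    show "(\<lambda>n. C * (real n * \<bar>q\<bar> ^ n)) \<longlonglongrightarrow> 0"
      using tendsto_mult_left[OF powser_times_n_limit_0[of "\<bar>q\<bar>"], of C] q by simp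
  qed
  then have "(\<lambda>n. p n * (1 + e n)) \<longlonglongrightarrow> L * (1 + 0)"
    by (intro tendsto_intros pL)
  moreover have "(\<Sum>j<2 * n. q ^ (j * (j + 1) div 2)) = p n * (1 + e n)" if "n > 0" for n
  proof -
    have "(\<Sum>j<2 * n. q ^ (j * (j + 1) div 2)) = (\<Sum>s<n. p n / p s * q ^ (s * (2 * n + 1)))"
      using shanks_triangular[OF q, of n] by (simp add: p_def)
    also have "{..<n} = insert 0 {1..<n}" using that by auto
    also have "(\<Sum>s\<in>\<dots>. p n / p s * q ^ (s * (2 * n + 1))) = p n / p 0 + (\<Sum>s\<in>{1..<n}. p n / p s * q ^ (s * (2 * n + 1)))"
      by (subst sum.insert) auto
    also have "(\<Sum>s\<in>{1..<n}. p n / p s * q ^ (s * (2 * n + 1))) = p n * e n"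
      unfolding e_def sum_distrib_left by (simp add: field_simps)
    also have "p 0 = 1" by (simp add: p_def)
    finally show ?thesis by (simp add: algebra_simps)
  qed
  then have "\<forall>\<^sub>F n in sequentially. p n * (1 + e n) = (\<Sum>j<2 * n. q ^ (j * (j + 1) div 2))"
    by (intro eventually_mono[OF eventually_gt_at_top[of 0]]) simp
  ultimately have lim: "(\<lambda>n. \<Sum>j<2 * n. q ^ (j * (j + 1) div 2)) \<longlonglongrightarrow> L"
    by (simp add: tendsto_cong)
  have "summable (\<lambda>n. q ^ (n * (n + 1) div 2))"
  proof (rule summable_comparison_test')
    show "summable (\<lambda>k. \<bar>q\<bar> ^ k)" using q by (intro summable_geometric) auto
    show "norm (q ^ (k * (k + 1) div 2)) \<le> \<bar>q\<bar> ^ k" for k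
    proof -
      have "k * 2 \<le> k * (k + 1)" by (cases k) auto
      then have "k \<le> k * (k + 1) div 2" by linarith
      then have "\<bar>q\<bar> ^ (k * (k + 1) div 2) \<le> \<bar>q\<bar> ^ k" using q by (intro power_decreasing) auto
      then show ?thesis by (simp add: power_abs)
    qed
  qed
  then have "(\<lambda>n. \<Sum>j<n. q ^ (j * (j + 1) div 2)) \<longlonglongrightarrow> ramanujan_psi q"
    unfolding ramanujan_psi_def by (rule summable_LIMSEQ)
  then have "(\<lambda>n. \<Sum>j<2 * n. q ^ (j * (j + 1) div 2)) \<longlonglongrightarrow> ramanujan_psi q"
    by (rule LIMSEQ_subseq_LIMSEQ[unfolded o_def]) (auto simp: strict_mono_def)
  from LIMSEQ_unique[OF this lim] show ?thesis unfolding L_def .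
qed

text \<open>The identity \<open>phi_psi\<close> at -q is solved for \<phi>(-q), after both values of
  \<psi> in it are replaced by their products.\<close>

lemma phi_minus_product:
  fixes q :: real
  assumes "q \<noteq> 0" "\<bar>q\<bar> < 1"
  shows "ramanujan_phi (- q) = qpochhammer_inf (q\<^sup>2) (q\<^sup>2) * (odd_qprod q)\<^sup>2"
proof -
  have q2: "\<bar>q\<^sup>2\<bar> < 1" using assms by (simp add: abs_square_less_1)
  have q4: "\<bar>(q\<^sup>2)\<^sup>2\<bar> < 1" unfolding abs_power2 using q2 by (rule abs_square_less_1[THEN iffD2])
  let ?E = "qpochhammer_inf ((q\<^sup>2)\<^sup>2) ((q\<^sup>2)\<^sup>2)" and ?a = "odd_qprod q" and ?b = "odd_qprod (- q)"
  have "ramanujan_phi (- q) * ramanujan_psi (q\<^sup>2) = (ramanujan_psi (- q))\<^sup>2"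
    using phi_psi[of "- q"] assms by simp
  moreover have "ramanujan_psi (q\<^sup>2) = ?E / (?a * ?b)"
    unfolding psi_product[OF q2] odd_qprod_minus[OF assms(2)] ..
  moreover have "ramanujan_psi (- q) = ?E * (?a * ?b) / ?b"
    using psi_product[of "- q"] assms(2) qpochhammer_self_split[OF q2]
    by (simp add: odd_qprod_minus)
  ultimately have "ramanujan_phi (- q) * ?E / (?a * ?b) = (?E * ?a)\<^sup>2"
    using odd_qprod_pos[of "- q"] assms(2) by simp
  then have "ramanujan_phi (- q) = ?E * (?a * ?b) * ?a\<^sup>2"
    using odd_qprod_pos[of "- q"] odd_qprod_pos[of q] qpochhammer_self_pos[OF q4] assms(2)
    by (simp add: field_simps power2_eq_square)
  then show ?thesis
    unfolding qpochhammer_self_split[OF q2] odd_qprod_minus[OF assms(2)] .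
qed

section \<open>The nome and the singular modulus\<close>

text \<open>For negative q the series has terms of both signs, so positivity is read off the
  product.\<close>

lemma phi_pos:
  assumes "q \<noteq> 0" "\<bar>q\<bar> < 1"
  shows "0 < ramanujan_phi q"
proof -
  have "\<bar>q\<^sup>2\<bar> < 1" using assms by (simp add: abs_square_less_1)
  then show ?thesis
    using phi_minus_product[of "- q"] assms odd_qprod_pos[of "- q"] qpochhammer_self_pos[of "q\<^sup>2"] by simp
qed

lemma psi_pos:
  assumes "\<bar>q\<bar> < 1"
  shows "0 < ramanujan_psi q"
proof -
  have "\<bar>q\<^sup>2\<bar> < 1" using assms by (simp add: abs_square_less_1)
  then show ?thesis
    using assms psi_product odd_qprod_pos qpochhammer_self_pos[of "q\<^sup>2"] by simp
qed

lemma psi_bounds: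
  assumes "0 \<le> q" "q < 1"
  shows "1 \<le> ramanujan_psi q" "ramanujan_psi q \<le> 1 / (1 - q)"
proof -
  have le: "q ^ (k * (k + 1) div 2) \<le> q ^ k" for k
  proof -
    have "k * 2 \<le> k * (k + 1)" by (cases k) auto
    then have "k \<le> k * (k + 1) div 2" by linarith
    then show ?thesis using assms by (intro power_decreasing) auto
  qed
  have geo: "(\<lambda>k. q ^ k) sums (1 / (1 - q))"
    using assms by (intro geometric_sums) auto
  have sm: "summable (\<lambda>k. q ^ (k * (k + 1) div 2))"
    using le assms by (intro summable_comparison_test'[OF sums_summable[OF geo]]) auto
  show "ramanujan_psi q \<le> 1 / (1 - q)"
    unfolding ramanujan_psi_def using sums_le[OF le summable_sums[OF sm] geo] .
  have "(\<Sum>k<1. q ^ (k * (k + 1) div 2)) \<le> (\<Sum>k. q ^ (k * (k + 1) div 2))"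
    using assms by (intro sum_le_suminf[OF sm]) auto
  then show "1 \<le> ramanujan_psi q" unfolding ramanujan_psi_def by simp
qed

section \<open>The modulus as a function of the nome\<close>

text \<open>In Jacobi's notation this is theta_2^4 / theta_3^4, the squared elliptic modulus at nome
  q.\<close>

definition nome_modulus :: "real \<Rightarrow> real" where
  "nome_modulus q = 16 * q * ramanujan_psi (q\<^sup>2) ^ 4 / ramanujan_phi q ^ 4"

text \<open>Jacobi's identity \<phi>(q)^4 - \<phi>(-q)^4 = 16 q \<psi>(q^2)^4: the difference
  factors into the two duplication formulas, and \<open>phi_psi\<close> at q^2 combines their right
  sides.\<close>

lemma one_minus_nome_modulus:
  assumes "0 < q" "q < 1"
  shows "1 - nome_modulus q = (ramanujan_phi (- q) / ramanujan_phi q) ^ 4"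
proof -
  have q: "q \<noteq> 0" "\<bar>q\<bar> < 1" "q\<^sup>2 \<noteq> 0" "\<bar>q\<^sup>2\<bar> < 1" using assms by (auto simp: abs_square_less_1)
  let ?a = "ramanujan_phi q" and ?b = "ramanujan_phi (- q)" and ?c = "ramanujan_phi (q\<^sup>2)"
    and ?d = "ramanujan_psi (q ^ 4)" and ?e = "ramanujan_psi (q\<^sup>2)"
  have "?c * ?d = ?e\<^sup>2" using phi_psi[OF q(3,4)] by (simp flip: power_mult)
  moreover have "?a ^ 4 - ?b ^ 4 = (?a\<^sup>2 + ?b\<^sup>2) * (?a\<^sup>2 - ?b\<^sup>2)"
    by (simp add: power2_eq_square power4_eq_xxxx algebra_simps)
  moreover have "\<dots> = 16 * q * (?c * ?d)\<^sup>2"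
    unfolding phi_square_add[OF q(1,2)] phi_square_diff[OF q(1,2)] by (simp add: power_mult_distrib)
  ultimately have "?a ^ 4 - ?b ^ 4 = 16 * q * ?e ^ 4" by (simp flip: power_mult)
  then have "16 * q * ?e ^ 4 = ?a ^ 4 - ?b ^ 4" ..
  then show ?thesis
    using phi_pos[OF q(1,2)] by (simp add: nome_modulus_def power_divide diff_divide_distrib)
qed

lemma nome_modulus_bounds:
  assumes "0 < q" "q < 1"
  shows "0 < nome_modulus q" "nome_modulus q < 1"
proof -
  have q: "q \<noteq> 0" "\<bar>q\<bar> < 1" "\<bar>q\<^sup>2\<bar> < 1" using assms by (auto simp: abs_square_less_1)
  show "0 < nome_modulus q"
    unfolding nome_modulus_def using phi_pos[OF q(1,2)] psi_pos[OF q(3)] assms by simp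
  have "0 < 1 - nome_modulus q"
    unfolding one_minus_nome_modulus[OF assms] using phi_pos[OF q(1,2)] phi_pos[of "- q"] q by simp
  then show "nome_modulus q < 1" by simp
qed

text \<open>Since \<phi>(q) = \<psi>(q)^2 / \<psi>(q^2), the modulus is 16 q (\<psi>(q^2) /
  \<psi>(q))^8, and \<open>psi_bounds\<close> controls the quotient. This determines ln \<alpha>(q)
  as ln (16 q) up to an error vanishing with q.\<close>

lemma nome_modulus_estimate:
  assumes "0 < q" "q < 1"
  shows "16 * q * (1 - q) ^ 8 \<le> nome_modulus q" "nome_modulus q \<le> 16 * q / (1 - q) ^ 8"
proof -
  have "q * q \<le> q" using assms by (simp add: mult_left_le)
  moreover from this have "q * q < 1" using assms by linarith
  ultimately have q: "q \<noteq> 0" "\<bar>q\<bar> < 1" "0 \<le> q\<^sup>2" "q\<^sup>2 \<le> q" "q\<^sup>2 < 1" "0 \<le> q"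
    using assms unfolding power2_eq_square by auto
  note b = psi_bounds[OF q(3,5)] psi_bounds[OF q(6) assms(2)]
  let ?e = "ramanujan_psi (q\<^sup>2)" and ?p = "ramanujan_psi q" and ?a = "ramanujan_phi q"
  have a: "?a = ?p\<^sup>2 / ?e" using phi_psi[OF q(1,2)] b by (simp add: field_simps)
  have eq: "nome_modulus q = 16 * q * ((?e ^ 8) / (?p ^ 8))"
    using b unfolding nome_modulus_def a by (simp add: power_divide flip: power_mult power_add)
  have "?e \<le> 1 / (1 - q\<^sup>2)" by (rule b)
  also have "\<dots> \<le> 1 / (1 - q)" using assms q by (intro divide_left_mono) auto
  finally have e: "?e \<le> 1 / (1 - q)" .
  have p: "1 - q \<le> 1 / ?p" using b assms by (simp add: field_simps)
  have "?e / ?p \<le> (1 / (1 - q)) / 1" using e b assms by (intro frac_le) auto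
  then have "(?e / ?p) ^ 8 \<le> (1 / (1 - q)) ^ 8" using b by (intro power_mono) auto
  then show "nome_modulus q \<le> 16 * q / (1 - q) ^ 8"
    unfolding eq using assms mult_left_mono[of "(?e / ?p) ^ 8" "(1 / (1 - q)) ^ 8" "16 * q"] by (simp add: power_divide)
  have "1 / ?p \<le> ?e / ?p" using b by (intro divide_right_mono) auto
  then have "(1 - q) ^ 8 \<le> (?e / ?p) ^ 8" using p assms by (intro power_mono) auto
  then show "16 * q * (1 - q) ^ 8 \<le> nome_modulus q"
    unfolding eq using assms mult_left_mono[of "(1 - q) ^ 8" "(?e / ?p) ^ 8" "16 * q"] by (simp add: power_divide)
qed

text \<open>For x = k^2 this is K'(k) / K(k), the ratio that defines the singular modulus.\<close>

definition period_ratio :: "real \<Rightarrow> real" where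
  "period_ratio x = elliptic_F (1 - x) / elliptic_F x"

lemma period_ratio_less:
  assumes "0 < x" "x < y" "y < 1"
  shows "period_ratio y < period_ratio x"
  unfolding period_ratio_def
proof (rule frac_less)
  show "0 \<le> elliptic_F (1 - y)" using assms elliptic_F_ge_1[of "1 - y"] by simp
  show "elliptic_F (1 - y) < elliptic_F (1 - x)" using assms by (intro elliptic_F_mono) auto
  show "0 < elliptic_F x" using assms elliptic_F_ge_1[of x] by simp
  show "elliptic_F x \<le> elliptic_F y" using assms by (intro less_imp_le elliptic_F_mono) auto
qed

text \<open>Let \<open>k'\<close> be the root of 1 - \<alpha>(q) and \<open>l\<close> the root of
  \<alpha>(q^2). The duplication formulas give l = (1 - k')/(1 + k'), so Landen's transformation
  applies at l to the denominators and at k' to the numerators. The two multipliers satisfy (1 +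
  l)(1 + k') = 2.\<close>

lemma period_ratio_double:
  assumes "0 < q" "q < 1"
  shows "period_ratio (nome_modulus (q\<^sup>2)) = 2 * period_ratio (nome_modulus q)"
proof -
  have q: "q \<noteq> 0" "\<bar>q\<bar> < 1" "q\<^sup>2 \<noteq> 0" "\<bar>q\<^sup>2\<bar> < 1" "0 < q\<^sup>2" "q\<^sup>2 < 1"
    using assms by (auto simp: abs_square_less_1)
  define k' where "k' = (ramanujan_phi (- q) / ramanujan_phi q)\<^sup>2"
  define l where "l = 4 * q * (ramanujan_psi (q ^ 4) / ramanujan_phi (q\<^sup>2))\<^sup>2"
  have pos: "0 < ramanujan_phi q" "0 < ramanujan_phi (- q)" "0 < ramanujan_phi (q\<^sup>2)"
    using phi_pos[of q] phi_pos[of "- q"] phi_pos[of "q\<^sup>2"] q by auto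
  have k'2: "k'\<^sup>2 = 1 - nome_modulus q"
    unfolding one_minus_nome_modulus[OF assms] k'_def by (simp flip: power_mult)
  have k'0: "0 < k'" using pos by (simp add: k'_def)
  have "k'\<^sup>2 < 1" using nome_modulus_bounds[OF assms] k'2 by simp
  with k'0 have k'1: "k' < 1" by (simp add: abs_square_less_1)
  have l2: "l\<^sup>2 = nome_modulus (q\<^sup>2)"
    unfolding l_def nome_modulus_def by (simp add: power_mult_distrib power_divide flip: power_mult)
  have "l = (8 * q * (ramanujan_psi (q ^ 4))\<^sup>2) / (2 * (ramanujan_phi (q\<^sup>2))\<^sup>2)"
    by (simp add: l_def power_divide)
  also have "\<dots> = ((ramanujan_phi q)\<^sup>2 - (ramanujan_phi (- q))\<^sup>2) / ((ramanujan_phi q)\<^sup>2 + (ramanujan_phi (- q))\<^sup>2)"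
    unfolding phi_square_add[OF q(1,2)] phi_square_diff[OF q(1,2)] ..
  also have "\<dots> = (1 - k') / (1 + k')"
    unfolding k'_def power_divide using pos by (simp add: divide_simps)
  finally have l: "l = (1 - k') / (1 + k')" .
  have l01: "0 \<le> l" "l < 1" using k'0 k'1 by (auto simp: l field_simps)
  have sum: "1 + l = 2 / (1 + k')" using k'0 by (simp add: l field_simps)
  have "4 * l / (1 + l)\<^sup>2 = 4 * ((1 - k') / (1 + k')) / (2 / (1 + k'))\<^sup>2"
    unfolding sum unfolding l ..
  also have "\<dots> = (1 - k') * (1 + k')"
    using k'0 by (simp add: power_divide power2_eq_square)
  also have "\<dots> = 1 - k'\<^sup>2" by (simp add: power2_eq_square algebra_simps)
  finally have 1: "4 * l / (1 + l)\<^sup>2 = nome_modulus q" using k'2 by simp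
  have "1 - l\<^sup>2 = (1 + l) * (1 - l)" by (simp add: power2_eq_square algebra_simps)
  also have "1 - l = 2 * k' / (1 + k')" using k'0 by (simp add: l field_simps)
  also have "(1 + l) * (2 * k' / (1 + k')) = 4 * k' / (1 + k')\<^sup>2"
    unfolding sum by (simp add: power2_eq_square)
  finally have 2: "1 - nome_modulus (q\<^sup>2) = 4 * k' / (1 + k')\<^sup>2" using l2 by simp
  have F1: "elliptic_F (nome_modulus q) = 2 / (1 + k') * elliptic_F (nome_modulus (q\<^sup>2))"
    using elliptic_F_landen[OF l01] unfolding 1 l2 unfolding sum .
  have F2: "elliptic_F (1 - nome_modulus (q\<^sup>2)) = (1 + k') * elliptic_F (1 - nome_modulus q)"
    using elliptic_F_landen[OF less_imp_le[OF k'0] k'1] unfolding 2 k'2 .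
  have F0: "0 < elliptic_F (nome_modulus (q\<^sup>2))"
    using nome_modulus_bounds[OF q(5,6)] elliptic_F_ge_1[of "nome_modulus (q\<^sup>2)"] by simp
  have "d * Y / X = 2 * (Y / (2 / d * X))" if "0 < X" "0 < d" for d X Y :: real
    using that by simp
  from this[OF F0] show ?thesis
    unfolding period_ratio_def F1 F2 using k'0 by simp
qed

text \<open>Along q^(2^n) the ratio grows by 2^n exactly, while F(\<alpha>) tends to 1 and F(1 -
  \<alpha>) is - ln \<alpha> / \<pi> up to a bounded error. Dividing by 2^n leaves - ln q /
  \<pi>.\<close>

lemma period_ratio_nome_modulus:
  assumes "0 < q" "q < 1"
  shows "period_ratio (nome_modulus q) = - ln q / pi"
proof -
  define Q where "Q = (\<lambda>n::nat. q ^ 2 ^ n)"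
  define A where "A = (\<lambda>n. nome_modulus (Q n))"
  have Q: "0 < Q n" "Q n < 1" for n using assms by (auto simp: Q_def power_less_one_iff)
  have lnQ: "ln (Q n) = 2 ^ n * ln q" for n using assms by (simp add: Q_def ln_realpow)
  have "Q n \<le> q ^ n" for n
    unfolding Q_def using assms less_exp[of n] by (intro power_decreasing) auto
  moreover have "(\<lambda>n. q ^ n) \<longlonglongrightarrow> 0" using assms by (intro LIMSEQ_power_zero) auto
  ultimately have Q0: "Q \<longlonglongrightarrow> 0"
    using Q by (intro tendsto_sandwich[of "\<lambda>_. 0" Q sequentially "\<lambda>n. q ^ n" 0] always_eventually allI)
      (auto intro: less_imp_le)
  have A: "0 < A n" "A n < 1" for n
    unfolding A_def by (rule nome_modulus_bounds[OF Q])+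
  have est: "16 * Q n * (1 - Q n) ^ 8 \<le> A n" "A n \<le> 16 * Q n / (1 - Q n) ^ 8" for n
    unfolding A_def by (rule nome_modulus_estimate[OF Q])+
  have "(\<lambda>n. 16 * Q n / (1 - Q n) ^ 8) \<longlonglongrightarrow> 16 * 0 / (1 - 0) ^ 8"
    by (intro tendsto_intros Q0) auto
  then have A0: "A \<longlonglongrightarrow> 0"
    using A(1) est(2)
    by (intro tendsto_sandwich[of "\<lambda>_. 0" A sequentially "\<lambda>n. 16 * Q n / (1 - Q n) ^ 8" 0] always_eventually allI)
      (auto intro: less_imp_le)
  have "(\<lambda>n. 1 / (1 - A n)) \<longlonglongrightarrow> 1 / (1 - 0)"
    by (intro tendsto_intros A0) auto
  then have FA: "(\<lambda>n. elliptic_F (A n)) \<longlonglongrightarrow> 1"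
    using A less_imp_le[OF A(1)]
    by (intro tendsto_sandwich[of "\<lambda>_. 1" "\<lambda>n. elliptic_F (A n)" sequentially "\<lambda>n. 1 / (1 - A n)" 1]
          always_eventually allI elliptic_F_ge_1 elliptic_F_le) auto
  have pow0: "(\<lambda>n. (1 / 2 :: real) ^ n) \<longlonglongrightarrow> 0" by (intro LIMSEQ_power_zero) auto
  \<comment> \<open>The logarithm of the modulus is 2^n ln q plus bounded terms, so the constant ln
    16 disappears after scaling by 2^(-n).\<close>
  have lnA: "ln 16 + 2 ^ n * ln q + 8 * ln (1 - Q n) \<le> ln (A n)"
    "ln (A n) \<le> ln 16 + 2 ^ n * ln q - 8 * ln (1 - Q n)" for n
  proof -
    have "ln (16 * Q n * (1 - Q n) ^ 8) \<le> ln (A n)"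
      using est(1)[of n] Q[of n] A[of n] by (subst ln_le_cancel_iff) auto
    then show "ln 16 + 2 ^ n * ln q + 8 * ln (1 - Q n) \<le> ln (A n)"
      using Q[of n] by (simp add: ln_mult ln_realpow lnQ)
    have "ln (A n) \<le> ln (16 * Q n / (1 - Q n) ^ 8)"
      using est(2)[of n] Q[of n] A[of n] by (subst ln_le_cancel_iff) auto
    then show "ln (A n) \<le> ln 16 + 2 ^ n * ln q - 8 * ln (1 - Q n)"
      using Q[of n] by (simp add: ln_mult ln_div ln_realpow lnQ)
  qed
  have "(\<lambda>n. (1 / 2) ^ n * (ln 16 + 8 * ln (1 - Q n)) + ln q) \<longlonglongrightarrow> 0 * (ln 16 + 8 * ln (1 - 0)) + ln q"
    by (intro tendsto_intros pow0 Q0) auto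
  then have lower: "(\<lambda>n. (1 / 2) ^ n * (ln 16 + 8 * ln (1 - Q n)) + ln q) \<longlonglongrightarrow> ln q" by simp
  have "(\<lambda>n. (1 / 2) ^ n * (ln 16 - 8 * ln (1 - Q n)) + ln q) \<longlonglongrightarrow> 0 * (ln 16 - 8 * ln (1 - 0)) + ln q"
    by (intro tendsto_intros pow0 Q0) auto
  then have upper: "(\<lambda>n. (1 / 2) ^ n * (ln 16 - 8 * ln (1 - Q n)) + ln q) \<longlonglongrightarrow> ln q" by simp
  have "(1 / 2) ^ n * (ln 16 + 8 * ln (1 - Q n)) + ln q \<le> (1 / 2) ^ n * ln (A n)"
     "(1 / 2) ^ n * ln (A n) \<le> (1 / 2) ^ n * (ln 16 - 8 * ln (1 - Q n)) + ln q" for n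
    using mult_left_mono[OF lnA(1)[of n], of "(1 / 2) ^ n"] mult_left_mono[OF lnA(2)[of n], of "(1 / 2) ^ n"]
    by (simp_all add: power_one_over field_simps)
  then have L: "(\<lambda>n. (1 / 2) ^ n * ln (A n)) \<longlonglongrightarrow> ln q"
    by (intro tendsto_sandwich[OF _ _ lower upper] always_eventually allI)
  have "(\<lambda>n. (1 / 2) ^ n * elliptic_F (1 - A n)) \<longlonglongrightarrow> - ln q / pi"
  proof (rule tendsto_sandwich[OF always_eventually always_eventually])
    have "(\<lambda>n. - ((1 / 2) ^ n * ln (A n)) / pi) \<longlonglongrightarrow> - ln q / pi"
      by (intro tendsto_intros L) auto
    then show "(\<lambda>n. - ((1 / 2) ^ n * ln (A n)) / pi) \<longlonglongrightarrow> - ln q / pi" .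
    have "(\<lambda>n. (1 / 2) ^ n + - ((1 / 2) ^ n * ln (A n)) / pi) \<longlonglongrightarrow> 0 + - ln q / pi"
      by (intro tendsto_intros L pow0) auto
    then show "(\<lambda>n. (1 / 2) ^ n + - ((1 / 2) ^ n * ln (A n)) / pi) \<longlonglongrightarrow> - ln q / pi" by simp
    show "\<forall>n. - ((1 / 2) ^ n * ln (A n)) / pi \<le> (1 / 2) ^ n * elliptic_F (1 - A n)"
    proof
      fix n
      have "- ln (A n) / pi \<le> elliptic_F (1 - A n)"
        using elliptic_F_log_lower[of "1 - A n"] A[of n] by simp
      from mult_left_mono[OF this, of "(1 / 2) ^ n"]
      show "- ((1 / 2) ^ n * ln (A n)) / pi \<le> (1 / 2) ^ n * elliptic_F (1 - A n)" by simp
    qed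
    show "\<forall>n. (1 / 2) ^ n * elliptic_F (1 - A n) \<le> (1 / 2) ^ n + - ((1 / 2) ^ n * ln (A n)) / pi"
    proof
      fix n
      have "elliptic_F (1 - A n) \<le> 1 - ln (A n) / pi"
        using elliptic_F_log_upper[of "1 - A n"] A[of n] by simp
      from mult_left_mono[OF this, of "(1 / 2) ^ n"]
      show "(1 / 2) ^ n * elliptic_F (1 - A n) \<le> (1 / 2) ^ n + - ((1 / 2) ^ n * ln (A n)) / pi"
        by (simp add: algebra_simps)
    qed
  qed
  then have "(\<lambda>n. (1 / 2) ^ n * elliptic_F (1 - A n) / elliptic_F (A n)) \<longlonglongrightarrow> (- ln q / pi) / 1"
    by (intro tendsto_divide FA) auto
  \<comment> \<open>By doubling, the scaled sequence is constant, so its limit is the value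
    sought.\<close>
  moreover have "(1 / 2) ^ n * elliptic_F (1 - A n) / elliptic_F (A n) = period_ratio (nome_modulus q)" for n
  proof -
    have "period_ratio (A n) = 2 ^ n * period_ratio (nome_modulus q)"
    proof (induction n)
      case (Suc n)
      have "Q (Suc n) = (Q n)\<^sup>2" by (simp add: Q_def mult.commute flip: power_mult)
      then have "period_ratio (A (Suc n)) = 2 * period_ratio (A n)"
        using period_ratio_double[OF Q, of n] by (simp add: A_def)
      with Suc show ?case by simp
    qed (simp add: A_def Q_def)
    then have "(1 / 2) ^ n * period_ratio (A n) = period_ratio (nome_modulus q)"
      by (simp add: power_one_over)
    then show ?thesis by (simp add: period_ratio_def)
  qed
  ultimately show ?thesis by (simp add: LIMSEQ_const_iff)
qed

section \<open>Singular moduli, class invariants and the cubic relation in terms of the nome\<close>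

text \<open>Existence comes from the value of the period ratio at \<open>nome_modulus\<close>,
  uniqueness from its strict monotonicity.\<close>

lemma singular_modulus_eq:
  assumes "0 < r"
  shows "singular_modulus r = nome_modulus (exp (- pi * sqrt r))"
proof -
  let ?q = "exp (- pi * sqrt r)"
  have q: "0 < ?q" "?q < 1" using assms by auto
  have eq: "period_ratio (nome_modulus ?q) = sqrt r"
    unfolding period_ratio_nome_modulus[OF q] by simp
  show ?thesis
    unfolding singular_modulus_def elliptic_F_def[symmetric] period_ratio_def[symmetric]
  proof (rule the_equality)
    show "0 < nome_modulus ?q \<and> nome_modulus ?q < 1 \<and> period_ratio (nome_modulus ?q) = sqrt r"
      using nome_modulus_bounds[OF q] eq by blast
    fix x assume x: "0 < x \<and> x < 1 \<and> period_ratio x = sqrt r"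
    show "x = nome_modulus ?q"
      using period_ratio_less[of x "nome_modulus ?q"] period_ratio_less[of "nome_modulus ?q" x]
        nome_modulus_bounds[OF q] eq x by (cases x "nome_modulus ?q" rule: linorder_cases) auto
  qed
qed

text \<open>The period ratio decreases in the modulus and, as - ln q / \<pi>, also in the nome;
  hence the modulus increases with the nome.\<close>

lemma nome_modulus_less:
  assumes "0 < p" "p < q" "q < 1"
  shows "nome_modulus p < nome_modulus q"
proof (rule ccontr)
  have p: "0 < p" "p < 1" and q: "0 < q" "q < 1" using assms by auto
  assume "\<not> ?thesis"
  then have "period_ratio (nome_modulus p) \<le> period_ratio (nome_modulus q)"
    using period_ratio_less[of "nome_modulus q" "nome_modulus p"] nome_modulus_bounds[OF p] nome_modulus_bounds[OF q]
    by (cases "nome_modulus p = nome_modulus q") auto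
  then have "ln q \<le> ln p"
    unfolding period_ratio_nome_modulus[OF p] period_ratio_nome_modulus[OF q] by (simp add: field_simps)
  then show False using assms by simp
qed

text \<open>The 24th power clears the fractional exponents. The cube of (q; q^2)_inf is \<phi>(-q) /
  \<psi>(q), and \<psi>(q)^8 = \<phi>(q)^4 \<psi>(q^2)^4 then expresses its 24th power through the
  modulus.\<close>

lemma class_invariant_g_pos_power:
  assumes "0 < r"
  defines "q \<equiv> exp (- pi * sqrt r)"
  shows "0 < class_invariant_g r"
    and "class_invariant_g r ^ 24 = (1 - nome_modulus q)\<^sup>2 / (4 * nome_modulus q)"
proof -
  have q: "0 < q" "q < 1" using assms by auto
  then have q': "q \<noteq> 0" "\<bar>q\<bar> < 1" "\<bar>q\<^sup>2\<bar> < 1" by (auto simp: abs_square_less_1)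
  have E: "0 < qpochhammer_inf (q\<^sup>2) (q\<^sup>2)" by (rule qpochhammer_self_pos[OF q'(3)])
  have O: "0 < odd_qprod q" by (rule odd_qprod_pos[OF q'(2)])
  have g: "class_invariant_g r = odd_qprod q / (2 powr (1/4) * q powr (1/24))"
    unfolding class_invariant_g_def Let_def q_def[symmetric] ramanujan_f_uminus
    using E by (simp add: qpochhammer_self_split[OF q'(2)])
  show "0 < class_invariant_g r" unfolding g using O q by simp
  have "(2 powr (1/4) :: real) ^ 24 = (2 powr (1/4)) powr (real 24)"
    by (rule powr_realpow[symmetric]) simp
  also have "\<dots> = 2 powr (real 6)" by (simp add: powr_powr)
  also have "\<dots> = 2 ^ 6" by (rule powr_realpow) simp
  finally have 1: "(2 powr (1/4) :: real) ^ 24 = 64" by simp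
  have "(q powr (1/24)) ^ 24 = (q powr (1/24)) powr (real 24)"
    using q by (intro powr_realpow[symmetric]) simp
  also have "\<dots> = q" using q by (simp add: powr_powr)
  finally have 2: "(q powr (1/24)) ^ 24 = q" .
  have "class_invariant_g r ^ 24 = (odd_qprod q ^ 3) ^ 8 / (64 * q)"
    unfolding g power_divide power_mult_distrib 1 2 by (simp flip: power_mult)
  also have "odd_qprod q ^ 3 = ramanujan_phi (- q) / ramanujan_psi q"
    unfolding phi_minus_product[OF q'(1,2)] psi_product[OF q'(2)] using E O
    by (simp add: power2_eq_square power3_eq_cube)
  also have "(ramanujan_phi (- q) / ramanujan_psi q) ^ 8 / (64 * q) = (1 - nome_modulus q)\<^sup>2 / (4 * nome_modulus q)"
  proof -
    let ?a = "ramanujan_phi q" and ?b = "ramanujan_phi (- q)" and ?e = "ramanujan_psi (q\<^sup>2)" and ?p = "ramanujan_psi q"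
    have pos: "0 < ?a" "0 < ?b" "0 < ?e" "0 < ?p"
      using phi_pos[of q] phi_pos[of "- q"] psi_pos[of q] psi_pos[of "q\<^sup>2"] q' by auto
    have "?p ^ 8 = (?p\<^sup>2) ^ 4" by (simp flip: power_mult)
    also have "\<dots> = ?a ^ 4 * ?e ^ 4"
      unfolding phi_psi[OF q'(1,2), symmetric] by (rule power_mult_distrib)
    finally have p8: "?p ^ 8 = ?a ^ 4 * ?e ^ 4" .
    have "(1 - nome_modulus q)\<^sup>2 = ?b ^ 8 / (?a ^ 4 * ?a ^ 4)"
      unfolding one_minus_nome_modulus[OF q] power_divide by (simp flip: power_mult power_add)
    then show ?thesis
      unfolding power_divide p8 nome_modulus_def using pos q by (simp add: field_simps)
  qed
  finally show "class_invariant_g r ^ 24 = (1 - nome_modulus q)\<^sup>2 / (4 * nome_modulus q)" .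
qed

text \<open>Legendre's equation in a form free of fourth roots: z is the fourth root of the product
  of the moduli, given as a theta quotient. It is \<open>phi_cubic\<close> divided by \<phi>(q)
  \<phi>(q^3).\<close>

lemma cubic_modular_equation:
  assumes "0 < q" "q < 1"
  obtains z where "z ^ 4 = nome_modulus q * nome_modulus (q ^ 3)"
    "(1 - z) ^ 4 = (1 - nome_modulus q) * (1 - nome_modulus (q ^ 3))"
proof
  have q: "q \<noteq> 0" "\<bar>q\<bar> < 1" "\<bar>q\<^sup>2\<bar> < 1" using assms by (auto simp: abs_square_less_1)
  have q3: "0 < q ^ 3" "q ^ 3 < 1" "\<bar>q ^ 6\<bar> < 1"
    using assms by (auto simp: power_less_one_iff power_abs)
  have pos: "0 < ramanujan_phi q" "0 < ramanujan_phi (q ^ 3)" "0 < ramanujan_psi (q\<^sup>2)" "0 < ramanujan_psi (q ^ 6)"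
    using phi_pos[of q] phi_pos[of "q ^ 3"] psi_pos[of "q\<^sup>2"] psi_pos[of "q ^ 6"] q q3 by auto
  let ?z = "4 * q * ramanujan_psi (q\<^sup>2) * ramanujan_psi (q ^ 6) / (ramanujan_phi q * ramanujan_phi (q ^ 3))"
  show "?z ^ 4 = nome_modulus q * nome_modulus (q ^ 3)"
    unfolding nome_modulus_def power_divide power_mult_distrib by (simp flip: power_mult power_Suc add: power_add[symmetric] mult_ac)
  have "1 - ?z = (ramanujan_phi (- q) / ramanujan_phi q) * (ramanujan_phi (- (q ^ 3)) / ramanujan_phi (q ^ 3))"
    unfolding phi_cubic[OF q(1,2), symmetric] using pos by (simp add: diff_divide_distrib)
  then show "(1 - ?z) ^ 4 = (1 - nome_modulus q) * (1 - nome_modulus (q ^ 3))"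
    unfolding one_minus_nome_modulus[OF assms] one_minus_nome_modulus[OF q3(1,2)] by (simp only: power_mult_distrib)
qed

section \<open>The cubic modular equation\<close>

text \<open>Here \<open>a\<close> stands for g^4. With s = sqrt \<alpha> and z = s x one has \<beta>
  = \<alpha> x^4, and the real solutions are x = v (U - Z) and x = v (U + Z), where U - Z = (X -
  Y)^2, U + Z = (X + Y)^2 and C = \<alpha> v^4. The inequality serves to tell the two roots
  apart.\<close>

lemma cubic_modulus_roots:
  fixes a \<alpha> \<beta> z :: real
  assumes "0 < a" "0 < \<alpha>" "\<alpha> < 1" and a: "a ^ 6 = (1 - \<alpha>)\<^sup>2 / (4 * \<alpha>)"
    and z: "z ^ 4 = \<alpha> * \<beta>" "(1 - z) ^ 4 = (1 - \<alpha>) * (1 - \<beta>)"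
  defines "T \<equiv> sqrt (a ^ 4 - a\<^sup>2 + 1)"
  defines "X \<equiv> sqrt ((a\<^sup>2 + 1 + T) / 2)" and "Y \<equiv> sqrt ((a\<^sup>2 - 1 + T) / 2)"
    and "C \<equiv> (sqrt (a ^ 6 + 1) - a ^ 3)\<^sup>2 * (sqrt (a\<^sup>2 + 1) - a) ^ 4"
  shows "\<beta> = C * (X - Y) ^ 8 \<or> \<beta> = C * (X + Y) ^ 8"
    and "C * (X - Y) ^ 8 \<le> C * (X + Y) ^ 8"
proof -
  define S U Z v w s where "S = sqrt (a\<^sup>2 + 1)" and "U = a\<^sup>2 + T" and "Z = 2 * X * Y"
    and "v = S - a" and "w = S + a" and "s = sqrt \<alpha>"
  have S2: "S\<^sup>2 = a\<^sup>2 + 1" by (simp add: S_def add_nonneg_nonneg)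
  have T2: "T\<^sup>2 = a ^ 4 - a\<^sup>2 + 1"
  proof -
    have "0 \<le> (a\<^sup>2 - 1 / 2)\<^sup>2 + 3 / 4" by simp
    also have "\<dots> = a ^ 4 - a\<^sup>2 + 1" by (simp add: power2_eq_square power4_eq_xxxx algebra_simps)
    finally show ?thesis by (simp add: T_def)
  qed
  have T0: "0 \<le> T" unfolding T_def using T2 by (cases "0 \<le> a ^ 4 - a\<^sup>2 + 1") (auto simp: T_def)
  have S0: "0 < S" by (simp add: S_def add_nonneg_pos)
  have "1 - a\<^sup>2 < T"
  proof (rule ccontr)
    assume "\<not> ?thesis"
    then have "T\<^sup>2 \<le> (1 - a\<^sup>2)\<^sup>2" using T0 by (intro power_mono) auto
    then show False using mult_pos_pos[OF \<open>0 < a\<close> \<open>0 < a\<close>] unfolding T2 by (simp add: power2_eq_square power4_eq_xxxx algebra_simps)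
  qed
  then have Y0: "0 < (a\<^sup>2 - 1 + T) / 2" by simp
  have X2: "X\<^sup>2 = (a\<^sup>2 + 1 + T) / 2" and Y2: "Y\<^sup>2 = (a\<^sup>2 - 1 + T) / 2"
    using T0 Y0 by (simp_all add: X_def Y_def)
  have X: "0 \<le> X" and Y: "0 < Y" using T0 Y0 by (simp_all add: X_def Y_def)
  have XY: "X\<^sup>2 + Y\<^sup>2 = U" "X\<^sup>2 - Y\<^sup>2 = 1" unfolding X2 Y2 U_def by (simp_all add: field_simps)
  have Z2: "Z\<^sup>2 = U\<^sup>2 - 1"
  proof -
    have "Z\<^sup>2 = (X\<^sup>2 + Y\<^sup>2)\<^sup>2 - (X\<^sup>2 - Y\<^sup>2)\<^sup>2" by (simp add: Z_def power2_eq_square algebra_simps)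
    then show ?thesis unfolding XY by simp
  qed
  have minus8: "(X - Y) ^ 8 = (U - Z) ^ 4"
  proof -
    have "(X - Y)\<^sup>2 = U - Z" unfolding XY(1)[symmetric] Z_def by (simp add: power2_eq_square algebra_simps)
    then show ?thesis by (metis mult_2_right numeral_Bit0 power_mult mult_2)
  qed
  have plus8: "(X + Y) ^ 8 = (U + Z) ^ 4"
  proof -
    have "(X + Y)\<^sup>2 = U + Z" unfolding XY(1)[symmetric] Z_def by (simp add: power2_eq_square algebra_simps)
    then show ?thesis by (metis mult_2_right numeral_Bit0 power_mult mult_2)
  qed
  have s: "0 < s" "s\<^sup>2 = \<alpha>" using assms by (simp_all add: s_def)
  have s1: "s\<^sup>2 < 1" using s assms by simp
  \<comment> \<open>A sum of cubes: a^6 + 1 = (a^2 + 1)(a^4 - a^2 + 1).\<close>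
  have sq6: "a ^ 6 + 1 = (S * T)\<^sup>2"
    unfolding power_mult_distrib S2 T2 by (simp add: algebra_simps power2_eq_square eval_nat_numeral)
  have sqrt6: "sqrt (a ^ 6 + 1) = S * T" unfolding sq6 using S0 T0 by simp
  have "(a ^ 3)\<^sup>2 = ((1 - s\<^sup>2) / (2 * s))\<^sup>2"
    using a unfolding s(2)[symmetric] by (simp add: power_divide power_mult_distrib flip: power_mult)
  then have "a ^ 3 = (1 - s\<^sup>2) / (2 * s)"
    by (rule power2_eq_imp_eq) (use \<open>0 < a\<close> s(1) s1 in simp_all)
  then have as: "2 * s * a ^ 3 = 1 - s\<^sup>2" using s by (simp add: field_simps)
  have "(s + a ^ 3)\<^sup>2 = s\<^sup>2 + 2 * s * a ^ 3 + (a ^ 3)\<^sup>2"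
    by (simp add: power2_eq_square algebra_simps)
  also have "\<dots> = (S * T)\<^sup>2"
    unfolding as sq6[symmetric] by (simp flip: power_mult)
  finally have "(s + a ^ 3)\<^sup>2 = (S * T)\<^sup>2" .
  then have "s + a ^ 3 = S * T"
    by (rule power2_eq_imp_eq) (use \<open>0 < a\<close> s(1) S0 T0 in simp_all)
  then have sST: "s = S * T - a ^ 3" by simp
  \<comment> \<open>The conjugate of s = S T - a^3 is its reciprocal, since (S T)^2 - a^6 =
    1.\<close>
  have inv: "s * (S * T + a ^ 3) = 1"
  proof -
    have "s * (S * T + a ^ 3) = s\<^sup>2 + 2 * s * a ^ 3"
      unfolding \<open>s + a ^ 3 = S * T\<close>[symmetric] by (simp add: power2_eq_square distrib_left)
    then show ?thesis unfolding as by simp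
  qed
  have vw: "v * w = 1" using S2 by (simp add: v_def w_def power2_eq_square algebra_simps)
  have v0: "0 < v"
  proof -
    have "a = sqrt (a\<^sup>2)" using \<open>0 < a\<close> by simp
    also have "\<dots> < S" unfolding S_def by (intro real_sqrt_less_mono) simp
    finally show ?thesis by (simp add: v_def)
  qed
  have C: "C = \<alpha> * v ^ 4"
    unfolding C_def sqrt6 sST[symmetric] s(2) S_def[symmetric] v_def ..
  define x where "x = z / s"
  have zx: "z = s * x" using s by (simp add: x_def)
  have \<beta>: "\<beta> = \<alpha> * x ^ 4"
  proof -
    have "\<alpha> * \<beta> = \<alpha> * (\<alpha> * x ^ 4)"
      using z(1) unfolding zx power_mult_distrib s(2)[symmetric] by (simp flip: power_mult power_add)
    then show ?thesis using assms by simp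
  qed
  \<comment> \<open>After expansion the terms 1 and s^4 x^4 cancel and a factor s can be
    removed.\<close>
  have quartic: "s * (x ^ 4 + 6 * x\<^sup>2 + 1) = 4 * (s\<^sup>2 * x ^ 3 + x)"
  proof -
    have "(1 - s * x) ^ 4 = (1 - s\<^sup>2) * (1 - s\<^sup>2 * x ^ 4)"
      using z(2) unfolding \<beta> zx s(2)[symmetric] .
    then have "s * (s * (x ^ 4 + 6 * x\<^sup>2 + 1)) = s * (4 * (s\<^sup>2 * x ^ 3 + x))"
      by (simp add: power2_eq_square algebra_simps eval_nat_numeral)
    then show ?thesis using s by simp
  qed
  have monic: "x ^ 4 - 4 * s * x ^ 3 + 6 * x\<^sup>2 - 4 * (S * T + a ^ 3) * x + 1 = 0"
  proof -
    have "(S * T + a ^ 3) * (s * (x ^ 4 + 6 * x\<^sup>2 + 1)) = (S * T + a ^ 3) * (4 * (s\<^sup>2 * x ^ 3 + x))"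
      unfolding quartic ..
    moreover have "(S * T + a ^ 3) * (s * (x ^ 4 + 6 * x\<^sup>2 + 1)) = (s * (S * T + a ^ 3)) * (x ^ 4 + 6 * x\<^sup>2 + 1)"
      by simp
    moreover have "(S * T + a ^ 3) * (4 * (s\<^sup>2 * x ^ 3 + x)) = 4 * ((s * (S * T + a ^ 3)) * s * x ^ 3 + (S * T + a ^ 3) * x)"
      by (simp add: power2_eq_square algebra_simps)
    ultimately show ?thesis unfolding inv by (simp add: algebra_simps)
  qed
  \<comment> \<open>The constant terms v^2 and w^2 are reciprocal; \<open>c3\<close>,
    \<open>c2\<close> and \<open>c1\<close> match the coefficients of x^3, x^2 and x.\<close>
  have factor: "(x\<^sup>2 - 2 * v * U * x + v\<^sup>2) * (x\<^sup>2 - 2 * w * (T - a\<^sup>2) * x + w\<^sup>2) =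
    x ^ 4 - 4 * s * x ^ 3 + 6 * x\<^sup>2 - 4 * (S * T + a ^ 3) * x + 1"
  proof -
    have c3: "v * U + w * (T - a\<^sup>2) = 2 * s"
      unfolding v_def w_def U_def sST by (simp add: power2_eq_square power3_eq_cube algebra_simps)
    have "v\<^sup>2 + w\<^sup>2 + 4 * (v * w) * (U * (T - a\<^sup>2)) = 2 * S\<^sup>2 + 2 * a\<^sup>2 + 4 * (T\<^sup>2 - a ^ 4)"
      unfolding vw unfolding v_def w_def U_def by (simp add: power2_eq_square power4_eq_xxxx algebra_simps)
    then have c2: "v\<^sup>2 + w\<^sup>2 + 4 * (v * w) * (U * (T - a\<^sup>2)) = 6"
      unfolding S2 T2 by simp
    have c1: "w * U + v * (T - a\<^sup>2) = 2 * (S * T + a ^ 3)"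
      unfolding v_def w_def U_def by (simp add: power2_eq_square power3_eq_cube algebra_simps)
    have "(x\<^sup>2 - 2 * v * U * x + v\<^sup>2) * (x\<^sup>2 - 2 * w * (T - a\<^sup>2) * x + w\<^sup>2) =
      x ^ 4 - 2 * (v * U + w * (T - a\<^sup>2)) * x ^ 3 + (v\<^sup>2 + w\<^sup>2 + 4 * (v * w) * (U * (T - a\<^sup>2))) * x\<^sup>2
        - 2 * ((v * w) * (w * U + v * (T - a\<^sup>2))) * x + (v * w)\<^sup>2"
      by (simp add: power2_eq_square power3_eq_cube power4_eq_xxxx algebra_simps)
    then show ?thesis unfolding c3 c2 c1 by (simp add: vw)
  qed
  \<comment> \<open>This quadratic has no real root because |T - a^2| < 1 makes its discriminant
    negative.\<close>
  have "0 < x\<^sup>2 - 2 * w * (T - a\<^sup>2) * x + w\<^sup>2"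
  proof -
    have "T < 1 + a\<^sup>2"
    proof (rule ccontr)
      assume "\<not> ?thesis"
      then have "(1 + a\<^sup>2)\<^sup>2 \<le> T\<^sup>2" by (intro power_mono) auto
      then show False using mult_pos_pos[OF \<open>0 < a\<close> \<open>0 < a\<close>] unfolding T2 by (simp add: power2_eq_square power4_eq_xxxx algebra_simps)
    qed
    moreover have "a\<^sup>2 - 1 < T"
    proof (rule ccontr)
      assume "\<not> ?thesis"
      then have "T\<^sup>2 \<le> (a\<^sup>2 - 1)\<^sup>2" using T0 by (intro power_mono) auto
      then show False using mult_pos_pos[OF \<open>0 < a\<close> \<open>0 < a\<close>] unfolding T2 by (simp add: power2_eq_square power4_eq_xxxx algebra_simps)
    qed
    ultimately have "(T - a\<^sup>2)\<^sup>2 < 1" by (simp add: abs_square_less_1 abs_less_iff)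
    moreover have "0 < w\<^sup>2" using S0 \<open>0 < a\<close> by (simp add: w_def)
    ultimately have "0 < w\<^sup>2 * (1 - (T - a\<^sup>2)\<^sup>2)" by simp
    then have "0 < (x - w * (T - a\<^sup>2))\<^sup>2 + w\<^sup>2 * (1 - (T - a\<^sup>2)\<^sup>2)"
      by (intro add_nonneg_pos) auto
    also have "\<dots> = x\<^sup>2 - 2 * w * (T - a\<^sup>2) * x + w\<^sup>2"
      by (simp add: power2_eq_square algebra_simps)
    finally show ?thesis .
  qed
  then have "x\<^sup>2 - 2 * v * U * x + v\<^sup>2 = 0"
    using factor monic by simp
  \<comment> \<open>Completing the square in the other quadratic; U^2 - 1 is the square of Z = 2 X Y
    because X^2 + Y^2 = U and X^2 - Y^2 = 1.\<close>
  then have "(x - v * U)\<^sup>2 = v\<^sup>2 * (U\<^sup>2 - 1)" by (simp add: power2_eq_square algebra_simps)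
  also have "\<dots> = (v * Z)\<^sup>2" unfolding Z2[symmetric] by (simp add: power_mult_distrib)
  finally have "x - v * U = v * Z \<or> x - v * U = - (v * Z)" by (rule power2_eq_iff[THEN iffD1])
  then have "x = v * (U + Z) \<or> x = v * (U - Z)" by (auto simp: algebra_simps)
  then show "\<beta> = C * (X - Y) ^ 8 \<or> \<beta> = C * (X + Y) ^ 8"
    unfolding \<beta> C minus8 plus8 by (auto simp: power_mult_distrib)
  have "U - Z = (X - Y)\<^sup>2" unfolding XY(1)[symmetric] Z_def by (simp add: power2_eq_square algebra_simps)
  then have "0 \<le> U - Z" by simp
  moreover have "0 \<le> Z" using X Y by (simp add: Z_def)
  ultimately have "(U - Z) ^ 4 \<le> (U + Z) ^ 4" by (intro power_mono) auto
  then show "C * (X - Y) ^ 8 \<le> C * (X + Y) ^ 8"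
    unfolding C minus8 plus8 using assms by (intro mult_left_mono) auto
qed

theorem theorem4p1:
  fixes n g :: real
  assumes "n \<in> \<rat>" and "n > 0"
    and "g = class_invariant_g n"
  shows "singular_modulus (9 * n) =
           (sqrt (g ^ 24 + 1) - g ^ 12) ^ 2 * (sqrt (g ^ 8 + 1) - g ^ 4) ^ 4 *
           (sqrt ((g ^ 8 + 1 + sqrt (g ^ 16 - g ^ 8 + 1)) / 2)
            - sqrt ((g ^ 8 - 1 + sqrt (g ^ 16 - g ^ 8 + 1)) / 2)) ^ 8 \<and>
         singular_modulus (n / 9) =
           (sqrt (g ^ 24 + 1) - g ^ 12) ^ 2 * (sqrt (g ^ 8 + 1) - g ^ 4) ^ 4 *
           (sqrt ((g ^ 8 + 1 + sqrt (g ^ 16 - g ^ 8 + 1)) / 2)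
            + sqrt ((g ^ 8 - 1 + sqrt (g ^ 16 - g ^ 8 + 1)) / 2)) ^ 8"
    (is "_ = ?L \<and> _ = ?R")
proof -
  \<comment> \<open>The nomes of levels n/9, n and 9n are p, q = p^3 and q^3, so the cubic relation
    links each outer level to n.\<close>
  define p where "p = exp (- pi * sqrt (n / 9))"
  define q where "q = exp (- pi * sqrt n)"
  have "sqrt n = 3 * sqrt (n / 9)" and s9: "sqrt (9 * n) = 3 * sqrt n"
    by (simp_all add: real_sqrt_divide real_sqrt_mult)
  then have qp: "q = p ^ 3"
    unfolding p_def q_def exp_of_nat_mult[symmetric] by simp
  have q3: "exp (- pi * sqrt (9 * n)) = q ^ 3"
    unfolding s9 q_def exp_of_nat_mult[symmetric] by (simp add: algebra_simps)
  have p: "0 < p" "p < 1" and q: "0 < q" "q < 1"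
    using assms(2) by (auto simp: p_def q_def)
  have qless: "q < p" "q ^ 3 < q"
    using power_strict_decreasing[of 1 3 p] power_strict_decreasing[of 1 3 q] p q by (simp_all add: qp)
  let ?\<alpha> = "nome_modulus q" and ?\<beta> = "nome_modulus (q ^ 3)" and ?\<gamma> = "nome_modulus p"
  have \<alpha>: "0 < ?\<alpha>" "?\<alpha> < 1" by (rule nome_modulus_bounds[OF q])+
  have less: "?\<beta> < ?\<alpha>" "?\<alpha> < ?\<gamma>"
    using nome_modulus_less[of "q ^ 3" q] nome_modulus_less[of q p] p q qless by auto
  have g: "0 < g ^ 4" "(g ^ 4) ^ 6 = (1 - ?\<alpha>)\<^sup>2 / (4 * ?\<alpha>)"
    using class_invariant_g_pos_power[OF assms(2)] by (simp_all add: assms(3) q_def flip: power_mult)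
  have roots: "x = ?L \<or> x = ?R" "?L \<le> ?R"
    if "z ^ 4 = ?\<alpha> * x" "(1 - z) ^ 4 = (1 - ?\<alpha>) * (1 - x)" for x z
    using cubic_modulus_roots[OF g(1) \<alpha> g(2) that] by (simp_all flip: power_mult)
  obtain y where y: "y ^ 4 = ?\<alpha> * ?\<beta>" "(1 - y) ^ 4 = (1 - ?\<alpha>) * (1 - ?\<beta>)"
    using cubic_modular_equation[OF q] by metis
  \<comment> \<open>Here level n is the upper end of the cubic relation; exchanging the factors puts
    its modulus in the same position as before.\<close>
  obtain z where z: "z ^ 4 = ?\<alpha> * ?\<gamma>" "(1 - z) ^ 4 = (1 - ?\<alpha>) * (1 - ?\<gamma>)"
    using cubic_modular_equation[OF p] unfolding qp by (metis mult.commute)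
  \<comment> \<open>Both moduli lie among the two values, the moduli are distinct with
    \<open>?\<beta>\<close> the smaller, and \<open>?L\<close> is at most \<open>?R\<close>; this
    fixes the assignment.\<close>
  have "?\<beta> = ?L" "?\<gamma> = ?R"
    using roots[OF y] roots[OF z] less by linarith+
  then show ?thesis
    using singular_modulus_eq[of "9 * n"] singular_modulus_eq[of "n / 9"] assms(2)
    unfolding q3 p_def[symmetric] by simp
qed

end
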